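(* Suppose the ellipticity assumption holds on $U$ and $|b(x)|\le M_2$ for all $x\in U$ with a constant $M_2\ge0$. There exist constants $C_*>0$ and $\nu>0$ (independent of $u$) such that the following holds for every $u\in C^2(U)\cap C(\widetilde U)$ that is bounded on $\gamma$ and is below exponential growth in $\widetilde U$. (i) Assume $Lu\le 0$ in $U$. Then $$\sup_{x\in \widetilde U} u(x)\le \sup_{x\in \mathcal S_{\theta_0}\cup\gamma} u(x),$$ $$\max_{x\in \mathcal S_\theta}u(x)\le M_\gamma\big(1-C_* e^{-\nu(\theta-\theta_0)}\big)+C_*\Big(\sup_{x\in \mathcal S_{\theta_0}\cup\gamma} u(x)\Big)e^{-\nu(\theta-\theta_0)}\quad\text{for all }\theta\ge\theta_0.$$ Consequently, $$\limsup_{\theta\to\infty}\Big(\max_{x\in \mathcal S_\theta}u(x)\Big)\le \limsup_{\theta\to\infty}M_\gamma(\theta).$$ (ii) Assume $Lu\ge 0$ in $U$. Then $$\inf_{x\in \widetilde U} u(x)\ge \inf_{x\in \mathcal S_{\theta_0}\cup\gamma} u(x),$$ $$\min_{x\in \mathcal S_\theta}u(x)\ge m_\gamma\big(1-C_*e^{-\nu(\theta-\theta_0)}\big)+C_*\Big(\inf_{x\in \mathcal S_{\theta_0}\cup\gamma} u(x)\Big)e^{-\nu(\theta-\theta_0)}\quad\text{for all }\theta\ge\theta_0.$$ Consequently, $$\liminf_{\theta\to\infty}\Big(\min_{x\in \mathcal S_\theta}u(x)\Big)\ge \liminf_{\theta\to\infty}m_\gamma(\theta).$$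
   Context: Domain. Let $X(r,\theta)=(r\cos\theta,r\sin\theta)$ for $r\ge0$, $\theta\in\mathbb R$. Fix $\theta_0\in\mathbb R$ and positive continuous functions $r_1,r_2$ on $[\theta_0,\infty)$ with $r_2(\theta+2\pi)<r_1(\theta)<r_2(\theta)$ for all $\theta\ge\theta_0$, and assume there is $r_*>0$ with $\lim_{\theta\to\infty}r_1(\theta)=\lim_{\theta\to\infty}r_2(\theta)=r_*$. Define $U=\{X(r,\theta):\theta>\theta_0,\ r_1(\theta)<r<r_2(\theta)\}$ (open and bounded), $\widetilde U=\{X(r,\theta):\theta\ge\theta_0,\ r_1(\theta)\le r\le r_2(\theta)\}$, $\gamma=\{X(r_i(\theta),\theta):\theta\ge\theta_0,\ i=1,2\}$, and $\mathcal S_\theta=\{X(r,\theta): r_1(\theta)\le r\le r_2(\theta)\}$ for $\theta\ge\theta_0$. Operator. $A=(a_{ij})$ is a function from $U$ to the real symmetric $2\times2$ matrices, $b:U\to\mathbb R^2$, and $Lu=-\sum_{i,j=1}^2 a_{ij}\frac{\partial^2u}{\partial x_i\partial x_j}+b\cdot\nabla u$ for $u\in C^2(U)$. Ellipticity assumption on $U$: there are constants $c_0>0$, $M_1>0$ such that $\xi^{\rm T}A(x)\xi\ge c_0|\xi|^2$ and $\mathrm{Tr}(A(x))\le M_1$ for all $x\in U$, $\xi\in\mathbb R^2$. A function $u:\widetilde U\to\mathbb R$ is below exponential growth in $\widetilde U$ if for any $\varepsilon>0$, $\lim_{\theta\to\infty}\big(e^{-\varepsilon\theta}\sup_{x\in\mathcal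 S_\theta}|u(x)|\big)=0$. Notation: $M_\gamma=\sup_{x\in\gamma}u(x)$, $m_\gamma=\inf_{x\in\gamma}u(x)$, and for $\theta\ge\theta_0$, $M_\gamma(\theta)=\max\{u(X(r_i(\theta),\theta)):i=1,2\}$, $m_\gamma(\theta)=\min\{u(X(r_i(\theta),\theta)):i=1,2\}$. *)

theory Defs
  imports "HOL-Analysis.Analysis"
begin

definition polar :: "real \<Rightarrow> real \<Rightarrow> real ^ 2" where
  "polar r \<theta> = vector [r * cos \<theta>, r * sin \<theta>]"

definition spiral_dom :: "real \<Rightarrow> (real \<Rightarrow> real) \<Rightarrow> (real \<Rightarrow> real) \<Rightarrow> (real ^ 2) set" where
  "spiral_dom \<theta>0 r1 r2 = {polar r \<theta> | r \<theta>. \<theta> > \<theta>0 \<and> r1 \<theta> < r \<and> r < r2 \<theta>}"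

definition spiral_ext :: "real \<Rightarrow> (real \<Rightarrow> real) \<Rightarrow> (real \<Rightarrow> real) \<Rightarrow> (real ^ 2) set" where
  "spiral_ext \<theta>0 r1 r2 = {polar r \<theta> | r \<theta>. \<theta> \<ge> \<theta>0 \<and> r1 \<theta> \<le> r \<and> r \<le> r2 \<theta>}"

definition spiral_curves :: "real \<Rightarrow> (real \<Rightarrow> real) \<Rightarrow> (real \<Rightarrow> real) \<Rightarrow> (real ^ 2) set" where
  "spiral_curves \<theta>0 r1 r2 =
     {polar (r1 \<theta>) \<theta> | \<theta>. \<theta> \<ge> \<theta>0} \<union> {polar (r2 \<theta>) \<theta> | \<theta>. \<theta> \<ge> \<theta>0}"

definition cross_section :: "(real \<Rightarrow> real) \<Rightarrow> (real \<Rightarrow> real) \<Rightarrow> real \<Rightarrow> (real ^ 2) set" where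
  "cross_section r1 r2 \<theta> = {polar r \<theta> | r. r1 \<theta> \<le> r \<and> r \<le> r2 \<theta>}"

(* Directional derivative along e_i; meaningful where u is differentiable. *)
definition partial :: "2 \<Rightarrow> (real ^ 2 \<Rightarrow> real) \<Rightarrow> real ^ 2 \<Rightarrow> real" where
  "partial i u x = frechet_derivative u (at x) (axis i 1)"

definition grad :: "(real ^ 2 \<Rightarrow> real) \<Rightarrow> real ^ 2 \<Rightarrow> real ^ 2" where
  "grad u x = (\<chi> i. partial i u x)"

(* Twice continuously differentiable on U (used for open U). Continuity of u and of its first
   partials is implied by their differentiability. *)
definition C2_on :: "(real ^ 2) set \<Rightarrow> (real ^ 2 \<Rightarrow> real) \<Rightarrow> bool" where
  "C2_on U u \<longleftrightarrow>
     (\<forall>x\<in>U. u differentiable (at x)) \<and>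
     (\<forall>i. \<forall>x\<in>U. partial i u differentiable (at x)) \<and>
     (\<forall>i j. continuous_on U (partial i (partial j u)))"

definition ell_op ::
  "(real ^ 2 \<Rightarrow> real ^ 2 ^ 2) \<Rightarrow> (real ^ 2 \<Rightarrow> real ^ 2) \<Rightarrow> (real ^ 2 \<Rightarrow> real) \<Rightarrow> real ^ 2 \<Rightarrow> real"
where
  "ell_op A b u x =
     - (\<Sum>i\<in>UNIV. \<Sum>j\<in>UNIV. A x $ i $ j * partial i (partial j u) x) + b x \<bullet> grad u x"

(* The supremum is taken in the extended reals, so an unbounded u on a cross-section counts as
   an infinite value rather than an unspecified real. *)
definition below_exp_growth ::
  "(real \<Rightarrow> real) \<Rightarrow> (real \<Rightarrow> real) \<Rightarrow> (real ^ 2 \<Rightarrow> real) \<Rightarrow> bool"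
where
  "below_exp_growth r1 r2 u \<longleftrightarrow>
     (\<forall>\<epsilon>>0. ((\<lambda>\<theta>. ereal (exp (- \<epsilon> * \<theta>)) * (SUP x\<in>cross_section r1 r2 \<theta>. ereal \<bar>u x\<bar>))
              \<longlongrightarrow> 0) at_top)"

(* Maximum and minimum over a cross-section. They are attained for continuous u, see
   section_max_attained and section_min_attained below. *)
definition section_max ::
  "(real \<Rightarrow> real) \<Rightarrow> (real \<Rightarrow> real) \<Rightarrow> (real ^ 2 \<Rightarrow> real) \<Rightarrow> real \<Rightarrow> real"
where
  "section_max r1 r2 u \<theta> = (SUP x\<in>cross_section r1 r2 \<theta>. u x)"

definition section_min ::
  "(real \<Rightarrow> real) \<Rightarrow> (real \<Rightarrow> real) \<Rightarrow> (real ^ 2 \<Rightarrow> real) \<Rightarrow> real \<Rightarrow> real"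
where
  "section_min r1 r2 u \<theta> = (INF x\<in>cross_section r1 r2 \<theta>. u x)"

definition curve_max ::
  "(real \<Rightarrow> real) \<Rightarrow> (real \<Rightarrow> real) \<Rightarrow> (real ^ 2 \<Rightarrow> real) \<Rightarrow> real \<Rightarrow> real"
where
  "curve_max r1 r2 u \<theta> = max (u (polar (r1 \<theta>) \<theta>)) (u (polar (r2 \<theta>) \<theta>))"

definition curve_min ::
  "(real \<Rightarrow> real) \<Rightarrow> (real \<Rightarrow> real) \<Rightarrow> (real ^ 2 \<Rightarrow> real) \<Rightarrow> real \<Rightarrow> real"
where
  "curve_min r1 r2 u \<theta> = min (u (polar (r1 \<theta>) \<theta>)) (u (polar (r2 \<theta>) \<theta>))"

lemma polar_altdef: "polar r \<theta> = r *\<^sub>R vector [cos \<theta>, sin \<theta>]"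
  by (simp add: polar_def vec_eq_iff forall_2)

lemma compact_cross_section: "compact (cross_section r1 r2 \<theta>)"
proof -
  have "cross_section r1 r2 \<theta> = (\<lambda>r. r *\<^sub>R vector [cos \<theta>, sin \<theta>]) ` {r1 \<theta>..r2 \<theta>}"
    by (auto simp: cross_section_def polar_altdef)
  then show ?thesis
    by (simp add: compact_continuous_image continuous_intros)
qed

lemma cross_section_nonempty: "r1 \<theta> \<le> r2 \<theta> \<Longrightarrow> cross_section r1 r2 \<theta> \<noteq> {}"
  by (auto simp: cross_section_def)

lemma section_max_attained:
  assumes "r1 \<theta> \<le> r2 \<theta>" "continuous_on (cross_section r1 r2 \<theta>) u"
  shows "\<exists>x\<in>cross_section r1 r2 \<theta>.
           u x = section_max r1 r2 u \<theta> \<and> (\<forall>y\<in>cross_section r1 r2 \<theta>. u y \<le> u x)"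
proof -
  obtain x where x: "x \<in> cross_section r1 r2 \<theta>" "\<forall>y\<in>cross_section r1 r2 \<theta>. u y \<le> u x"
    using continuous_attains_sup[OF compact_cross_section cross_section_nonempty] assms by blast
  then have "section_max r1 r2 u \<theta> = u x"
    unfolding section_max_def by (intro cSup_eq_maximum) auto
  with x show ?thesis by auto
qed

lemma section_min_attained:
  assumes "r1 \<theta> \<le> r2 \<theta>" "continuous_on (cross_section r1 r2 \<theta>) u"
  shows "\<exists>x\<in>cross_section r1 r2 \<theta>.
           u x = section_min r1 r2 u \<theta> \<and> (\<forall>y\<in>cross_section r1 r2 \<theta>. u x \<le> u y)"
proof -
  obtain x where x: "x \<in> cross_section r1 r2 \<theta>" "\<forall>y\<in>cross_section r1 r2 \<theta>. u x \<le> u y"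
    using continuous_attains_inf[OF compact_cross_section cross_section_nonempty] assms by blast
  then have "section_min r1 r2 u \<theta> = u x"
    unfolding section_min_def by (intro cInf_eq_minimum) auto
  with x show ?thesis by auto
qed

end

theory Submission
  imports Defs
begin

text \<open>
  On the strip $r$ stays in a compact subinterval $[r_*, R]$ of $(0,\infty)$. For such $r$ the function
  $$w_\mu(r,\theta) = e^{\mu\theta}\,\bigl(2 - e^{k(r^2-R^2)}\bigr)$$
  is a strict supersolution, $L w_\mu > 0$, as soon as $k$ is large and $|\mu|\le\nu$ is small: the
  second radial derivative contributes $4k^2r^2a_{rr}e^{k(r^2-R^2)}$, which beats the drift because
  $a_{rr}\ge c_0$, and every term produced by the factor $e^{\mu\theta}$ carries a factor $\mu$
  (lemma \<open>barrier_constants\<close>). Moreover $e^{\mu\theta}\le w_\mu\le 2e^{\mu\theta}$.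

  Both signs of $\mu$ are used. The growing barrier $\varepsilon w_\nu$ dominates $u$ far out along the
  spiral, since $u$ is below exponential growth; this is a Phragmen-Lindelof argument, and it
  reduces everything to a maximum principle on a compact piece $\theta_1\le\theta\le T$. The decaying
  barrier $w_{-\nu}$ measures how the data on the initial cross-section are forgotten. Thus if
  $u \le a + c\,w_{-\nu}$ holds on the boundary, with $c\ge0$, then it holds everywhere
  (lemma \<open>comparison\<close>). Taking $c=0$ and $a$ a bound for all boundary values gives the maximum principle;
  taking $a = M_\gamma$ and $c$ so that $c\,w_{-\nu}$ is at least $\sup u - M_\gamma$ (supremum over
  $\mathcal S_{\theta_0}\cup\gamma$) at $\theta_0$ gives the decay estimate, with $C_* = 2$ coming
  from the upper bound for $w_{-\nu}$. The rate $\nu$ does not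
  depend on the angle at which the strip is cut off, so restarting at a large angle $\theta_1$, beyond
  which the boundary values are nearly below their upper limit, gives the statement on upper limits.
  The assertions about supersolutions follow by passing to $-u$.

  The angle $\theta$ is not a function on the plane, only on the strip. The comparison is therefore made
  in the parameters $(r,\theta)$: a maximum of $u(X(r,\theta)) - G(r,\theta)$ in the interior of
  the parameter region is tested along straight lines $t\mapsto x+t\xi$, whose polar coordinates
  are explicit for small $t$ (lemma \<open>polar_along_line\<close>).
\<close>

section \<open>Contact along a line\<close>

lemma second_derivative_at_local_max:
  fixes g g' :: "real \<Rightarrow> real"
  assumes g: "\<forall>\<^sub>F t in nhds 0. (g has_real_derivative g' t) (at t)"
    and g': "(g' has_real_derivative h) (at 0)"
    and le: "\<forall>\<^sub>F t in nhds 0. g t \<le> g 0"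
  shows "g' 0 = 0" "h \<le> 0"
proof -
  obtain e where "e > 0"
    and e: "\<And>t. \<bar>t\<bar> < e \<Longrightarrow> (g has_real_derivative g' t) (at t)"
      "\<And>t. \<bar>t\<bar> < e \<Longrightarrow> g t \<le> g 0"
    using eventually_conj[OF g le] unfolding eventually_nhds_metric dist_real_def by auto
  show g'0: "g' 0 = 0"
    using DERIV_local_max[of g "g' 0" 0 e] e \<open>e > 0\<close> by (auto simp: abs_minus_commute)
  show "h \<le> 0"
  proof (rule ccontr)
    assume "\<not> h \<le> 0"
    then obtain d where "d > 0" and d: "\<And>t. 0 < t \<Longrightarrow> t < d \<Longrightarrow> g' 0 < g' (0 + t)"
      using DERIV_pos_inc_right[OF g'] by force
    define t where "t = min d e / 2"
    have t: "0 < t" "t < d" "t < e" using \<open>d > 0\<close> \<open>e > 0\<close> by (auto simp: t_def)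
    have "g 0 < g t"
    proof (rule DERIV_pos_imp_increasing_open[OF \<open>0 < t\<close>])
      fix s assume "0 < s" "s < t"
      then show "\<exists>y. (g has_real_derivative y) (at s) \<and> 0 < y"
        using e(1)[of s] d[of s] g'0 t by auto
    next
      show "continuous_on {0..t} g"
        using e(1) t by (force intro!: continuous_at_imp_continuous_on DERIV_isCont)
    qed
    then show False using e(2)[of t] t by auto
  qed
qed

lemma frechet_derivative_eq_partials:
  assumes "u differentiable (at x)"
  shows "frechet_derivative u (at x) \<xi> = (\<Sum>i\<in>UNIV. \<xi> $ i * partial i u x)"
proof -
  have lin: "linear (frechet_derivative u (at x))"
    by (rule linear_frechet_derivative[OF assms])
  have "\<xi> = (\<Sum>i\<in>UNIV. \<xi> $ i *\<^sub>R axis i 1)"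
    using basis_expansion[of \<xi>] by (simp add: scalar_mult_eq_scaleR)
  then have "frechet_derivative u (at x) \<xi> = frechet_derivative u (at x) (\<Sum>i\<in>UNIV. \<xi> $ i *\<^sub>R axis i 1)"
    by simp
  also have "\<dots> = (\<Sum>i\<in>UNIV. \<xi> $ i * partial i u x)"
    by (simp add: linear_sum[OF lin] linear_cmul[OF lin] partial_def)
  finally show ?thesis .
qed

lemma derivative_along_line:
  fixes u :: "real ^ 2 \<Rightarrow> real"
  assumes "u differentiable (at (x + t *\<^sub>R \<xi>))"
  shows "((\<lambda>t. u (x + t *\<^sub>R \<xi>)) has_real_derivative
           (\<Sum>i\<in>UNIV. \<xi> $ i * partial i u (x + t *\<^sub>R \<xi>))) (at t)"
proof -
  let ?D = "frechet_derivative u (at (x + t *\<^sub>R \<xi>))"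
  have D: "(u has_derivative ?D) (at (x + t *\<^sub>R \<xi>))"
    using assms frechet_derivative_works by blast
  have "((\<lambda>t. x + t *\<^sub>R \<xi>) has_derivative (\<lambda>s. s *\<^sub>R \<xi>)) (at t)"
    by (auto intro!: derivative_eq_intros)
  from has_derivative_compose[OF this D]
  have "((\<lambda>t. u (x + t *\<^sub>R \<xi>)) has_derivative (\<lambda>s. ?D (s *\<^sub>R \<xi>))) (at t)" .
  moreover have "?D (s *\<^sub>R \<xi>) = ?D \<xi> * s" for s
    using linear_cmul[OF linear_frechet_derivative[OF assms], of s \<xi>] by simp
  ultimately show ?thesis
    by (simp add: has_field_derivative_def frechet_derivative_eq_partials[OF assms])
qed

text \<open>
  If $u$ is touched from above along a line by a function $G$ of one variable (up to a constant), then
  the first derivatives agree and the second ones are ordered. Testing only along lines keeps the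
  comparison function one-dimensional, so that its partial derivatives never have to be formed.
\<close>

lemma contact_along_line:
  fixes u :: "real ^ 2 \<Rightarrow> real" and G G' :: "real \<Rightarrow> real"
  assumes u: "\<forall>\<^sub>F t in nhds 0. u differentiable (at (x + t *\<^sub>R \<xi>))"
    and u': "\<And>i. partial i u differentiable (at x)"
    and G: "\<forall>\<^sub>F t in nhds 0. (G has_real_derivative G' t) (at t)"
    and G': "(G' has_real_derivative G'') (at 0)"
    and le: "\<forall>\<^sub>F t in nhds 0. u (x + t *\<^sub>R \<xi>) - G t \<le> u x - G 0"
  shows "(\<Sum>i\<in>UNIV. \<xi> $ i * partial i u x) = G' 0"
    and "(\<Sum>i\<in>UNIV. \<Sum>j\<in>UNIV. \<xi> $ i * \<xi> $ j * partial i (partial j u) x) \<le> G''"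
proof -
  define g where "g = (\<lambda>t. u (x + t *\<^sub>R \<xi>) - G t)"
  define g' where "g' = (\<lambda>t. (\<Sum>i\<in>UNIV. \<xi> $ i * partial i u (x + t *\<^sub>R \<xi>)) - G' t)"
  have 1: "\<forall>\<^sub>F t in nhds 0. (g has_real_derivative g' t) (at t)"
    using u G unfolding g_def g'_def
    by eventually_elim (intro DERIV_diff derivative_along_line)
  have 2: "((\<lambda>t. \<Sum>i\<in>UNIV. \<xi> $ i * partial i u (x + t *\<^sub>R \<xi>)) has_real_derivative
      (\<Sum>j\<in>UNIV. \<xi> $ j * (\<Sum>i\<in>UNIV. \<xi> $ i * partial i (partial j u) x))) (at 0)"
    using derivative_along_line[of "partial _ u" x 0 \<xi>] u'
    by (intro DERIV_sum DERIV_cmult) auto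
  have 3: "(\<Sum>j\<in>UNIV. \<xi> $ j * (\<Sum>i\<in>UNIV. \<xi> $ i * partial i (partial j u) x)) =
      (\<Sum>i\<in>UNIV. \<Sum>j\<in>UNIV. \<xi> $ i * \<xi> $ j * partial i (partial j u) x)"
    by (simp add: sum_2 algebra_simps)
  have 4: "(g' has_real_derivative
      ((\<Sum>i\<in>UNIV. \<Sum>j\<in>UNIV. \<xi> $ i * \<xi> $ j * partial i (partial j u) x) - G'')) (at 0)"
    unfolding g'_def using 2 G' unfolding 3 by (rule DERIV_diff)
  have 5: "\<forall>\<^sub>F t in nhds 0. g t \<le> g 0" using le by (simp add: g_def)
  show "(\<Sum>i\<in>UNIV. \<xi> $ i * partial i u x) = G' 0"
    using second_derivative_at_local_max(1)[OF 1 4 5] by (simp add: g'_def)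
  show "(\<Sum>i\<in>UNIV. \<Sum>j\<in>UNIV. \<xi> $ i * \<xi> $ j * partial i (partial j u) x) \<le> G''"
    using second_derivative_at_local_max(2)[OF 1 4 5] by simp
qed

section \<open>The operator in the polar frame\<close>

definition radial_dir :: "real \<Rightarrow> real ^ 2" where
  "radial_dir \<theta> = vector [cos \<theta>, sin \<theta>]"

definition angular_dir :: "real \<Rightarrow> real ^ 2" where
  "angular_dir \<theta> = vector [- sin \<theta>, cos \<theta>]"

lemma frame_nth [simp]:
  "radial_dir \<theta> $ 1 = cos \<theta>" "radial_dir \<theta> $ 2 = sin \<theta>"
  "angular_dir \<theta> $ 1 = - sin \<theta>" "angular_dir \<theta> $ 2 = cos \<theta>"
  by (simp_all add: radial_dir_def angular_dir_def)

lemma frame_orthonormal [simp]: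
  "radial_dir \<theta> \<bullet> radial_dir \<theta> = 1" "angular_dir \<theta> \<bullet> angular_dir \<theta> = 1"
  "radial_dir \<theta> \<bullet> angular_dir \<theta> = 0" "angular_dir \<theta> \<bullet> radial_dir \<theta> = 0"
  using sin_cos_squared_add3[of \<theta>] by (simp_all add: inner_vec_def sum_2 add.commute)

lemma frame_expansion:
  "v = (v \<bullet> radial_dir \<theta>) *\<^sub>R radial_dir \<theta> + (v \<bullet> angular_dir \<theta>) *\<^sub>R angular_dir \<theta>"
proof -
  have "(v * c + w * s) * c - (w * c - v * s) * s = v * (s * s + c * c)"
    "(v * c + w * s) * s + (w * c - v * s) * c = w * (s * s + c * c)" for v w c s :: real
    by algebra+
  then show ?thesis
    using sin_cos_squared_add3[of \<theta>]
    by (simp add: vec_eq_iff forall_2 inner_vec_def sum_2 add.commute[of "sin \<theta> * sin \<theta>"])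
qed

text \<open>
  Rotating a symmetric matrix into the polar frame and back: $\alpha,\beta,\delta$ are the entries in the
  frame, and the right-hand sides are the Cartesian entries.
\<close>

lemma frame_entries_identity:
  fixes a b d c s :: real
  assumes "s\<^sup>2 + c\<^sup>2 = 1"
  defines "\<alpha> \<equiv> a * c\<^sup>2 + 2 * b * c * s + d * s\<^sup>2"
    and "\<beta> \<equiv> b * (c\<^sup>2 - s\<^sup>2) + (d - a) * c * s"
    and "\<delta> \<equiv> a * s\<^sup>2 - 2 * b * c * s + d * c\<^sup>2"
  shows "\<alpha> * c\<^sup>2 - 2 * \<beta> * c * s + \<delta> * s\<^sup>2 = a"
    and "\<alpha> * c * s + \<beta> * (c\<^sup>2 - s\<^sup>2) - \<delta> * c * s = b"
    and "\<alpha> * s\<^sup>2 + 2 * \<beta> * c * s + \<delta> * c\<^sup>2 = d"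
proof -
  have "\<alpha> * c\<^sup>2 - 2 * \<beta> * c * s + \<delta> * s\<^sup>2 = a * (s\<^sup>2 + c\<^sup>2)\<^sup>2"
    "\<alpha> * c * s + \<beta> * (c\<^sup>2 - s\<^sup>2) - \<delta> * c * s = b * (s\<^sup>2 + c\<^sup>2)\<^sup>2"
    "\<alpha> * s\<^sup>2 + 2 * \<beta> * c * s + \<delta> * c\<^sup>2 = d * (s\<^sup>2 + c\<^sup>2)\<^sup>2"
    unfolding \<alpha>_def \<beta>_def \<delta>_def by algebra+
  then show "\<alpha> * c\<^sup>2 - 2 * \<beta> * c * s + \<delta> * s\<^sup>2 = a"
    "\<alpha> * c * s + \<beta> * (c\<^sup>2 - s\<^sup>2) - \<delta> * c * s = b"
    "\<alpha> * s\<^sup>2 + 2 * \<beta> * c * s + \<delta> * c\<^sup>2 = d"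
    by (simp_all only: assms(1) power_one mult_1_right)
qed

lemma frame_quadratic_form:
  fixes A :: "real ^ 2 ^ 2" and \<theta> :: real
  assumes "A $ 2 $ 1 = A $ 1 $ 2"
  defines "e \<equiv> radial_dir \<theta>" and "f \<equiv> angular_dir \<theta>" and "c \<equiv> cos \<theta>" and "s \<equiv> sin \<theta>"
  shows "e \<bullet> (A *v e) = A $ 1 $ 1 * c\<^sup>2 + 2 * A $ 1 $ 2 * c * s + A $ 2 $ 2 * s\<^sup>2"
    and "e \<bullet> (A *v f) = A $ 1 $ 2 * (c\<^sup>2 - s\<^sup>2) + (A $ 2 $ 2 - A $ 1 $ 1) * c * s"
    and "f \<bullet> (A *v f) = A $ 1 $ 1 * s\<^sup>2 - 2 * A $ 1 $ 2 * c * s + A $ 2 $ 2 * c\<^sup>2"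
proof -
  have "e $ 1 = c" "e $ 2 = s" "f $ 1 = - s" "f $ 2 = c"
    by (simp_all add: e_def f_def c_def s_def)
  then show "e \<bullet> (A *v e) = A $ 1 $ 1 * c\<^sup>2 + 2 * A $ 1 $ 2 * c * s + A $ 2 $ 2 * s\<^sup>2"
    "e \<bullet> (A *v f) = A $ 1 $ 2 * (c\<^sup>2 - s\<^sup>2) + (A $ 2 $ 2 - A $ 1 $ 1) * c * s"
    "f \<bullet> (A *v f) = A $ 1 $ 1 * s\<^sup>2 - 2 * A $ 1 $ 2 * c * s + A $ 2 $ 2 * c\<^sup>2"
    by (simp_all add: assms(1) inner_vec_def matrix_vector_mult_def sum_2 algebra_simps power2_eq_square)
qed

lemma frame_hessian_expand:
  fixes h :: "2 \<Rightarrow> 2 \<Rightarrow> real" and \<theta> :: real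
  defines "H \<equiv> \<lambda>\<xi> :: real ^ 2. \<Sum>i\<in>UNIV. \<Sum>j\<in>UNIV. \<xi> $ i * \<xi> $ j * h i j"
    and "c \<equiv> cos \<theta>" and "s \<equiv> sin \<theta>"
  shows "\<alpha> * H (radial_dir \<theta> + y *\<^sub>R angular_dir \<theta>) + (\<delta> - \<alpha> * y\<^sup>2) * H (angular_dir \<theta>) =
      (\<alpha> * c\<^sup>2 - 2 * (\<alpha> * y) * c * s + \<delta> * s\<^sup>2) * h 1 1
    + (\<alpha> * c * s + (\<alpha> * y) * (c\<^sup>2 - s\<^sup>2) - \<delta> * c * s) * (h 1 2 + h 2 1)
    + (\<alpha> * s\<^sup>2 + 2 * (\<alpha> * y) * c * s + \<delta> * c\<^sup>2) * h 2 2"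
proof -
  have "radial_dir \<theta> $ 1 = c" "radial_dir \<theta> $ 2 = s" "angular_dir \<theta> $ 1 = - s" "angular_dir \<theta> $ 2 = c"
    by (simp_all add: c_def s_def)
  then show ?thesis
    by (simp add: H_def sum_2 algebra_simps power2_eq_square del: frame_nth)
qed

text \<open>
  Completing the square, $A = \alpha\,\eta\eta^T + (\delta-\alpha y^2)\,\tau\tau^T$ with
  $\eta = e + y\tau$ and $\alpha y = \beta$, where $e,\tau$ is the polar frame. This writes the principal part
  of the operator as a combination of two second directional derivatives without diagonalizing $A$.
\<close>

lemma symmetric_contract_frame:
  fixes A :: "real ^ 2 ^ 2" and h :: "2 \<Rightarrow> 2 \<Rightarrow> real"
  defines "H \<equiv> \<lambda>\<xi> :: real ^ 2. \<Sum>i\<in>UNIV. \<Sum>j\<in>UNIV. \<xi> $ i * \<xi> $ j * h i j"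
  assumes sym: "transpose A = A"
    and \<alpha>: "\<alpha> = radial_dir \<theta> \<bullet> (A *v radial_dir \<theta>)"
    and \<beta>: "\<alpha> * y = radial_dir \<theta> \<bullet> (A *v angular_dir \<theta>)"
    and \<delta>: "\<delta> = angular_dir \<theta> \<bullet> (A *v angular_dir \<theta>)"
  shows "(\<Sum>i\<in>UNIV. \<Sum>j\<in>UNIV. A $ i $ j * h i j) =
    \<alpha> * H (radial_dir \<theta> + y *\<^sub>R angular_dir \<theta>) + (\<delta> - \<alpha> * y\<^sup>2) * H (angular_dir \<theta>)"
proof -
  have a21: "A $ 2 $ 1 = A $ 1 $ 2"
    using arg_cong[OF sym, of "\<lambda>B. B $ 1 $ 2"] by (simp add: transpose_def)
  have "\<alpha> * H (radial_dir \<theta> + y *\<^sub>R angular_dir \<theta>) + (\<delta> - \<alpha> * y\<^sup>2) * H (angular_dir \<theta>) =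
      A $ 1 $ 1 * h 1 1 + A $ 1 $ 2 * (h 1 2 + h 2 1) + A $ 2 $ 2 * h 2 2"
    unfolding H_def frame_hessian_expand
    unfolding \<beta>
    unfolding \<alpha> \<delta> frame_quadratic_form[OF a21]
      frame_entries_identity[OF sin_cos_squared_add] ..
  also have "\<dots> = (\<Sum>i\<in>UNIV. \<Sum>j\<in>UNIV. A $ i $ j * h i j)"
    by (simp add: sum_2 a21 distrib_left)
  finally show ?thesis ..
qed

text \<open>
  The comparison function enters only through its restrictions $G_{p,q}$ to the lines in direction
  $pe+q\tau$; $D_i$ and $Q_{ij}$ are its gradient and Hessian in the polar frame. Both weights in the
  decomposition of $A$ into two squares are nonnegative, so the ordering of second derivatives along
  the two directions gives the ordering of the principal parts; the gradients agree, hence so do the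
  drift terms.
\<close>

lemma ell_op_ge_at_contact:
  fixes u :: "real ^ 2 \<Rightarrow> real" and G G' :: "real \<Rightarrow> real \<Rightarrow> real \<Rightarrow> real" and \<theta> :: real
  defines "\<xi> \<equiv> \<lambda>p q. p *\<^sub>R radial_dir \<theta> + q *\<^sub>R angular_dir \<theta>"
  assumes sym: "transpose (A x) = A x"
    and pos: "\<And>\<xi>. \<xi> \<bullet> (A x *v \<xi>) \<ge> c0 * (norm \<xi>)\<^sup>2" "c0 > 0"
    and u: "\<And>p q. \<forall>\<^sub>F t in nhds 0. u differentiable (at (x + t *\<^sub>R \<xi> p q))"
    and u': "\<And>i. partial i u differentiable (at x)"
    and G: "\<And>p q. \<forall>\<^sub>F t in nhds 0. (G p q has_real_derivative G' p q t) (at t)"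
    and G': "\<And>p q. (G' p q has_real_derivative (Q11 * p\<^sup>2 + 2 * Q12 * p * q + Q22 * q\<^sup>2)) (at 0)"
    and G'0: "\<And>p q. G' p q 0 = D1 * p + D2 * q"
    and le: "\<And>p q. \<forall>\<^sub>F t in nhds 0. u (x + t *\<^sub>R \<xi> p q) - G p q t \<le> u x - G p q 0"
  shows "ell_op A b u x \<ge>
    - ((radial_dir \<theta> \<bullet> (A x *v radial_dir \<theta>)) * Q11
       + 2 * (radial_dir \<theta> \<bullet> (A x *v angular_dir \<theta>)) * Q12
       + (angular_dir \<theta> \<bullet> (A x *v angular_dir \<theta>)) * Q22)
    + (b x \<bullet> radial_dir \<theta>) * D1 + (b x \<bullet> angular_dir \<theta>) * D2"
proof -
  define \<alpha> \<beta> \<delta> where abd: "\<alpha> = radial_dir \<theta> \<bullet> (A x *v radial_dir \<theta>)"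
    "\<beta> = radial_dir \<theta> \<bullet> (A x *v angular_dir \<theta>)" "\<delta> = angular_dir \<theta> \<bullet> (A x *v angular_dir \<theta>)"
  have \<beta>2: "angular_dir \<theta> \<bullet> (A x *v radial_dir \<theta>) = \<beta>"
    unfolding abd by (metis dot_lmul_matrix inner_commute sym transpose_matrix_vector)
  have "c0 \<le> \<alpha>" using pos(1)[of "radial_dir \<theta>"] by (simp add: power2_norm_eq_inner abd)
  then have "\<alpha> > 0" using pos(2) by simp
  define y where "y = \<beta> / \<alpha>"
  have y: "\<beta> / \<alpha> = y" "\<beta> = \<alpha> * y" "\<beta>\<^sup>2 / \<alpha> = \<alpha> * y\<^sup>2"
    using \<open>\<alpha> > 0\<close> by (simp_all add: y_def power2_eq_square)
  \<comment> \<open>the Schur complement of the radial entry is the value of the form at a vector A-orthogonal to the radial direction\<close>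
  have "0 \<le> (angular_dir \<theta> - y *\<^sub>R radial_dir \<theta>) \<bullet> (A x *v (angular_dir \<theta> - y *\<^sub>R radial_dir \<theta>))"
    using pos(1)[of "angular_dir \<theta> - y *\<^sub>R radial_dir \<theta>"] pos(2)
    by (meson less_imp_le mult_nonneg_nonneg order_trans zero_le_power2)
  also have "\<dots> = \<delta> - y * \<beta> - (y * \<beta> - y * (y * \<alpha>))"
    using \<beta>2
    by (simp add: matrix_vector_mult_diff_distrib matrix_vector_mult_scaleR inner_diff_left
        inner_diff_right right_diff_distrib flip: abd)
  also have "\<dots> = \<delta> - \<beta>\<^sup>2 / \<alpha>"
    unfolding y(3) unfolding y(2) by (simp add: power2_eq_square)
  finally have \<delta>': "0 \<le> \<delta> - \<beta>\<^sup>2 / \<alpha>" .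
  define H where "H = (\<lambda>\<xi> :: real ^ 2. \<Sum>i\<in>UNIV. \<Sum>j\<in>UNIV. \<xi> $ i * \<xi> $ j * partial i (partial j u) x)"
  note c = contact_along_line[OF u u' G G' le]
  have HQ: "H (\<xi> p q) \<le> Q11 * p\<^sup>2 + 2 * Q12 * p * q + Q22 * q\<^sup>2" for p q
    unfolding H_def by (rule c(2))
  have gradD: "(\<Sum>i\<in>UNIV. \<xi> p q $ i * partial i u x) = D1 * p + D2 * q" for p q
    using c(1)[of p q] by (simp only: G'0)
  have g1: "grad u x \<bullet> radial_dir \<theta> = D1"
    using gradD[of 1 0] by (simp add: \<xi>_def inner_vec_def grad_def mult.commute)
  have g2: "grad u x \<bullet> angular_dir \<theta> = D2"
    using gradD[of 0 1] by (simp add: \<xi>_def inner_vec_def grad_def mult.commute)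
  have drift: "b x \<bullet> grad u x = (b x \<bullet> radial_dir \<theta>) * D1 + (b x \<bullet> angular_dir \<theta>) * D2"
    by (subst frame_expansion[of "b x" \<theta>]) (simp add: inner_add_right g1[symmetric] g2[symmetric]
        inner_commute[of _ "grad u x"])
  have "(\<Sum>i\<in>UNIV. \<Sum>j\<in>UNIV. A x $ i $ j * partial i (partial j u) x) =
      \<alpha> * H (\<xi> 1 y) + (\<delta> - \<alpha> * y\<^sup>2) * H (\<xi> 0 1)"
    using symmetric_contract_frame[OF sym abd(1) _ abd(3), of y "\<lambda>i j. partial i (partial j u) x"]
    by (simp only: y(2)[symmetric] abd(2)[symmetric] \<xi>_def H_def scaleR_one scaleR_zero_left add_0_left)
  also have "\<dots> \<le> \<alpha> * (Q11 * 1\<^sup>2 + 2 * Q12 * 1 * y + Q22 * y\<^sup>2)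
      + (\<delta> - \<alpha> * y\<^sup>2) * (Q11 * 0\<^sup>2 + 2 * Q12 * 0 * 1 + Q22 * 1\<^sup>2)"
    using \<open>\<alpha> > 0\<close> \<delta>' unfolding y(3) by (intro add_mono mult_left_mono HQ) auto
  also have "\<dots> = \<alpha> * Q11 + 2 * \<beta> * Q12 + \<delta> * Q22"
    unfolding y(2) by (simp add: algebra_simps)
  finally show ?thesis
    unfolding ell_op_def abd[symmetric] drift by simp
qed

section \<open>The barrier along a straight line\<close>

lemma polar_frame: "polar r \<theta> = r *\<^sub>R radial_dir \<theta>"
  by (simp add: polar_altdef radial_dir_def)

text \<open>
  For as long as the line stays on the same side of the tangential axis through the origin, that is
  for $r+tp>0$, the arctangent continues the angle; this covers small $t$, and $t=1$ for points near
  the base point.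
\<close>

lemma polar_along_line:
  assumes "r + t * p > 0"
  shows "polar r \<theta> + t *\<^sub>R (p *\<^sub>R radial_dir \<theta> + q *\<^sub>R angular_dir \<theta>) =
     polar (sqrt ((r + t * p)\<^sup>2 + (t * q)\<^sup>2)) (\<theta> + arctan (t * q / (r + t * p)))"
proof -
  define m where "m = r + t * p"
  define y where "y = t * q / m"
  have m: "m > 0" using assms by (simp add: m_def)
  have "sqrt (m\<^sup>2 + (t * q)\<^sup>2) = sqrt (m\<^sup>2 * (1 + y\<^sup>2))"
    using m by (simp add: y_def field_simps)
  also have "\<dots> = m * sqrt (1 + y\<^sup>2)"
    using m by (simp add: real_sqrt_mult)
  finally have rho: "sqrt (m\<^sup>2 + (t * q)\<^sup>2) = m * sqrt (1 + y\<^sup>2)" .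
  have my: "m * y = t * q" using m by (simp add: y_def)
  have nz: "sqrt (1 + y\<^sup>2) \<noteq> 0" by (smt (verit) real_sqrt_gt_zero zero_le_power2)
  have 1: "sqrt (m\<^sup>2 + (t * q)\<^sup>2) * cos (arctan y) = m" "sqrt (m\<^sup>2 + (t * q)\<^sup>2) * sin (arctan y) = t * q"
    using nz unfolding rho by (simp_all add: cos_arctan sin_arctan my)
  let ?\<rho> = "sqrt (m\<^sup>2 + (t * q)\<^sup>2)"
  have "?\<rho> * cos (\<theta> + arctan y) = cos \<theta> * (?\<rho> * cos (arctan y)) - sin \<theta> * (?\<rho> * sin (arctan y))"
    "?\<rho> * sin (\<theta> + arctan y) = sin \<theta> * (?\<rho> * cos (arctan y)) + cos \<theta> * (?\<rho> * sin (arctan y))"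
    by (simp_all add: cos_add sin_add algebra_simps)
  then have 2: "?\<rho> * cos (\<theta> + arctan y) = cos \<theta> * m - sin \<theta> * (t * q)"
    "?\<rho> * sin (\<theta> + arctan y) = sin \<theta> * m + cos \<theta> * (t * q)"
    unfolding 1 .
  show ?thesis
    unfolding m_def[symmetric] y_def[symmetric]
    by (simp add: vec_eq_iff forall_2 polar_frame 2) (simp add: m_def algebra_simps)
qed

text \<open>
  The radial factor is written in terms of $r^2$ because $r^2$ is a quadratic polynomial along every line.
\<close>

definition barrier :: "real \<Rightarrow> real \<Rightarrow> real \<Rightarrow> real \<Rightarrow> real \<Rightarrow> real" where
  "barrier k R \<mu> r \<theta> = exp (\<mu> * \<theta>) * (2 - exp (k * (r\<^sup>2 - R\<^sup>2)))"

definition barrier_line :: "real \<Rightarrow> real \<Rightarrow> real \<Rightarrow> real \<Rightarrow> real \<Rightarrow> real \<Rightarrow> real \<Rightarrow> real \<Rightarrow> real" where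
  "barrier_line k R \<mu> r \<theta> p q t =
     barrier k R \<mu> (sqrt ((r + t * p)\<^sup>2 + (t * q)\<^sup>2)) (\<theta> + arctan (t * q / (r + t * p)))"

definition barrier_line' :: "real \<Rightarrow> real \<Rightarrow> real \<Rightarrow> real \<Rightarrow> real \<Rightarrow> real \<Rightarrow> real \<Rightarrow> real \<Rightarrow> real" where
  "barrier_line' k R \<mu> r \<theta> p q t =
     exp (\<mu> * (\<theta> + arctan (t * q / (r + t * p)))) *
       (\<mu> * (q * r / ((r + t * p)\<^sup>2 + (t * q)\<^sup>2)) * (2 - exp (k * ((r + t * p)\<^sup>2 + (t * q)\<^sup>2 - R\<^sup>2)))
        - k * (2 * p * (r + t * p) + 2 * q * (t * q)) * exp (k * ((r + t * p)\<^sup>2 + (t * q)\<^sup>2 - R\<^sup>2)))"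

lemma arctan_line_derivative:
  assumes "r + t * p > 0"
  shows "((\<lambda>t. arctan (t * q / (r + t * p))) has_real_derivative q * r / ((r + t * p)\<^sup>2 + (t * q)\<^sup>2)) (at t)"
proof -
  define m where "m = r + t * p"
  have m: "m > 0" using assms by (simp add: m_def)
  have nz: "m\<^sup>2 + (t * q)\<^sup>2 \<noteq> 0" using m by (smt (verit) zero_less_power zero_le_power2)
  have "((\<lambda>t. arctan (t * q / (r + t * p))) has_real_derivative
      inverse (1 + (t * q / m)\<^sup>2) * ((q * m - t * q * p) / (m * m))) (at t)"
    using m by (auto intro!: derivative_eq_intros simp: m_def)
  moreover have "inverse (1 + (t * q / m)\<^sup>2) * ((q * m - t * q * p) / (m * m)) = q * r / (m\<^sup>2 + (t * q)\<^sup>2)"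
  proof -
    have "1 + (t * q / m)\<^sup>2 = (m\<^sup>2 + (t * q)\<^sup>2) / m\<^sup>2" using m by (simp add: field_simps)
    moreover have "q * m - t * q * p = q * r" by (simp add: m_def algebra_simps)
    ultimately show ?thesis using m by (simp add: field_simps power2_eq_square)
  qed
  ultimately show ?thesis by (simp add: m_def)
qed

lemma barrier_line_derivative:
  assumes "r + t * p > 0"
  shows "(barrier_line k R \<mu> r \<theta> p q has_real_derivative barrier_line' k R \<mu> r \<theta> p q t) (at t)"
proof -
  have chain: "((\<lambda>t. exp (\<mu> * \<phi> t) * (2 - exp (k * (S t - R\<^sup>2)))) has_real_derivative
      exp (\<mu> * \<phi> t) * (\<mu> * \<phi>' * (2 - exp (k * (S t - R\<^sup>2))) - k * S' * exp (k * (S t - R\<^sup>2)))) (at t)"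
    if "(\<phi> has_real_derivative \<phi>') (at t)" "(S has_real_derivative S') (at t)" for \<phi> S :: "real \<Rightarrow> real" and \<phi>' S'
    by (rule derivative_eq_intros that refl)+ (simp add: algebra_simps)
  have ang: "((\<lambda>t. \<theta> + arctan (t * q / (r + t * p))) has_real_derivative q * r / ((r + t * p)\<^sup>2 + (t * q)\<^sup>2)) (at t)"
    using DERIV_add[OF DERIV_const arctan_line_derivative[OF assms]] by simp
  have rad: "((\<lambda>t. (r + t * p)\<^sup>2 + (t * q)\<^sup>2) has_real_derivative
      2 * p * (r + t * p) + 2 * q * (t * q)) (at t)"
    by (auto intro!: derivative_eq_intros)
  have "barrier_line k R \<mu> r \<theta> p q = (\<lambda>t. exp (\<mu> * (\<theta> + arctan (t * q / (r + t * p)))) *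
      (2 - exp (k * ((r + t * p)\<^sup>2 + (t * q)\<^sup>2 - R\<^sup>2))))"
    by (simp add: barrier_line_def barrier_def fun_eq_iff)
  then show ?thesis
    using chain[OF ang rad] unfolding barrier_line'_def by (simp only:)
qed

lemma barrier_line'_0:
  assumes "r > 0"
  shows "barrier_line' k R \<mu> r \<theta> p q 0 =
    exp (\<mu> * \<theta>) * (- 2 * k * r * exp (k * (r\<^sup>2 - R\<^sup>2))) * p
    + exp (\<mu> * \<theta>) * (\<mu> / r * (2 - exp (k * (r\<^sup>2 - R\<^sup>2)))) * q"
  using assms by (simp add: barrier_line'_def field_simps power2_eq_square)

text \<open>
  The coefficients of $p^2$, $2pq$ and $q^2$ are the entries of the Hessian of the barrier in the polar
  frame.
\<close>

lemma barrier_line_second_derivative: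
  fixes k R r :: real
  assumes "r > 0"
  defines "E \<equiv> exp (k * (r\<^sup>2 - R\<^sup>2))"
  shows "(barrier_line' k R \<mu> r \<theta> p q has_real_derivative
     (exp (\<mu> * \<theta>) * (- 2 * k * E - 4 * k\<^sup>2 * r\<^sup>2 * E) * p\<^sup>2
      + 2 * (exp (\<mu> * \<theta>) * (- (2 - E) * \<mu> / r\<^sup>2 - 2 * \<mu> * k * E)) * p * q
      + exp (\<mu> * \<theta>) * ((2 - E) * \<mu>\<^sup>2 / r\<^sup>2 - 2 * k * E) * q\<^sup>2)) (at 0)"
proof -
  have a: "((\<lambda>t. arctan (t * q / (r + t * p))) has_real_derivative q / r) (at 0)"
    using arctan_line_derivative[of r 0 p q] assms(1) by (simp add: power2_eq_square)
  show ?thesis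
    unfolding barrier_line'_def E_def using assms(1)
    by (auto intro!: derivative_eq_intros a simp: field_simps power2_eq_square)
qed

section \<open>Strict supersolutions\<close>

text \<open>
  This is $e^{-\mu\theta}L$ applied to the barrier, at a point where $\alpha,\beta,\delta$ are the entries
  of $A$ in the polar frame and $b_1,b_2$ the components of the drift.
\<close>

definition barrier_op ::
  "real \<Rightarrow> real \<Rightarrow> real \<Rightarrow> real \<Rightarrow> real \<Rightarrow> real \<Rightarrow> real \<Rightarrow> real \<Rightarrow> real \<Rightarrow> real" where
  "barrier_op k R \<mu> r \<alpha> \<beta> \<delta> b1 b2 =
     (let E = exp (k * (r\<^sup>2 - R\<^sup>2)) in
      - (\<alpha> * (- 2 * k * E - 4 * k\<^sup>2 * r\<^sup>2 * E)
         + 2 * \<beta> * (- (2 - E) * \<mu> / r\<^sup>2 - 2 * \<mu> * k * E)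
         + \<delta> * ((2 - E) * \<mu>\<^sup>2 / r\<^sup>2 - 2 * k * E))
      + b1 * (- 2 * k * r * E) + b2 * (\<mu> / r * (2 - E)))"

text \<open>
  The three groups of terms in $L w_\mu$ are treated separately. The trace contributes a nonnegative
  term. The choice $2kr_*c_0 = M_2+1$ makes the quadratic term in $k$ exceed the radial drift by at least
  $2kr_*E_0$, where $E_0$ is the smallest value of $e^{k(r^2-R^2)}$. The remaining terms are bounded by
  $K\nu$, and $\nu$ is chosen to make this at most half of the gain.
\<close>

lemma barrier_constants:
  assumes "0 < rs" "0 < c0" "0 \<le> M1" "0 \<le> M2"
  obtains k \<nu> where "0 < k" "0 < \<nu>"
    "\<And>\<mu> r \<alpha> \<beta> \<delta> b1 b2. \<lbrakk>\<bar>\<mu>\<bar> \<le> \<nu>; rs \<le> r; r \<le> R; c0 \<le> \<alpha>; 0 \<le> \<delta>; \<delta> \<le> M1; \<bar>\<beta>\<bar> \<le> M1;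
       \<bar>b1\<bar> \<le> M2; \<bar>b2\<bar> \<le> M2\<rbrakk> \<Longrightarrow> 0 < barrier_op k R \<mu> r \<alpha> \<beta> \<delta> b1 b2"
proof -
  define k where "k = (M2 + 1) / (2 * rs * c0)"
  define E0 where "E0 = exp (k * (rs\<^sup>2 - R\<^sup>2))"
  define K where "K = 6 * M1 / rs\<^sup>2 + 4 * M1 * k + 2 * M2 / rs"
  define \<nu> where "\<nu> = min 1 (k * rs * E0 / (K + 1))"
  have k: "k > 0" "2 * k * rs * c0 = M2 + 1" using assms by (simp_all add: k_def)
  have "K \<ge> 0" using assms k by (simp add: K_def)
  have E0: "E0 > 0" by (simp add: E0_def)
  have main0: "0 < k * rs * E0" using k E0 assms by simp
  then have \<nu>: "0 < \<nu>" "\<nu> \<le> 1" using \<open>K \<ge> 0\<close> by (simp_all add: \<nu>_def)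
  have "\<nu> * K \<le> \<nu> * (K + 1)" using \<nu> by simp
  also have "\<dots> \<le> k * rs * E0 / (K + 1) * (K + 1)"
    using \<open>K \<ge> 0\<close> by (intro mult_right_mono) (simp_all add: \<nu>_def)
  also have "\<dots> = k * rs * E0" using \<open>K \<ge> 0\<close> by simp
  finally have \<nu>K: "\<nu> * K \<le> k * rs * E0" .
  have "0 < barrier_op k R \<mu> r \<alpha> \<beta> \<delta> b1 b2"
    if h: "\<bar>\<mu>\<bar> \<le> \<nu>" "rs \<le> r" "r \<le> R" "c0 \<le> \<alpha>" "0 \<le> \<delta>" "\<delta> \<le> M1" "\<bar>\<beta>\<bar> \<le> M1" "\<bar>b1\<bar> \<le> M2" "\<bar>b2\<bar> \<le> M2"
    for \<mu> r \<alpha> \<beta> \<delta> b1 b2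
  proof -
    define E where "E = exp (k * (r\<^sup>2 - R\<^sup>2))"
    have "r > 0" using h assms by simp
    have "E \<le> 1" using h k \<open>r > 0\<close> by (simp add: E_def mult_le_0_iff power_mono)
    have "E > 0" by (simp add: E_def)
    have "E0 \<le> E" using h k assms by (simp add: E_def E0_def power_mono)
    have F: "0 \<le> 2 - E" "2 - E \<le> 2" using \<open>E \<le> 1\<close> \<open>E > 0\<close> by auto
    \<comment> \<open>trace term, radial gain against radial drift, and the terms containing \<open>\<mu>\<close>\<close>
    have split: "barrier_op k R \<mu> r \<alpha> \<beta> \<delta> b1 b2 = 2 * k * E * (\<alpha> + \<delta>) + 2 * k * r * E * (2 * k * r * \<alpha> - b1)
       + (2 * \<beta> * (2 - E) * \<mu> / r\<^sup>2 + 4 * \<beta> * \<mu> * k * E - \<delta> * (2 - E) * \<mu>\<^sup>2 / r\<^sup>2 + b2 * (2 - E) * \<mu> / r)"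
      unfolding barrier_op_def Let_def E_def[symmetric] using \<open>r > 0\<close>
      by (simp add: field_simps power2_eq_square)
    have p1: "0 \<le> 2 * k * E * (\<alpha> + \<delta>)" using k \<open>E > 0\<close> h assms by simp
    have "M2 + 1 \<le> 2 * k * r * \<alpha>"
      unfolding k(2)[symmetric] using k h assms \<open>r > 0\<close> by (intro mult_mono) auto
    then have "1 \<le> 2 * k * r * \<alpha> - b1" using h by linarith
    then have "2 * k * r * E * 1 \<le> 2 * k * r * E * (2 * k * r * \<alpha> - b1)"
      using k \<open>r > 0\<close> \<open>E > 0\<close> by (intro mult_left_mono) auto
    moreover have "2 * k * rs * E0 \<le> 2 * k * r * E"
      using k h assms E0 \<open>E0 \<le> E\<close> \<open>r > 0\<close> by (intro mult_mono) auto
    ultimately have p2: "2 * k * rs * E0 \<le> 2 * k * r * E * (2 * k * r * \<alpha> - b1)" by simp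
    have "\<bar>2 * \<beta> * (2 - E) * \<mu> / r\<^sup>2\<bar> = 2 * \<bar>\<beta>\<bar> * (2 - E) * \<bar>\<mu>\<bar> / r\<^sup>2"
      using F by (simp add: abs_mult)
    also have "\<dots> \<le> 2 * M1 * 2 * \<nu> / rs\<^sup>2"
      using F h assms \<nu> by (intro frac_le mult_mono power_mono) auto
    finally have q1: "\<bar>2 * \<beta> * (2 - E) * \<mu> / r\<^sup>2\<bar> \<le> 2 * M1 * 2 * \<nu> / rs\<^sup>2" .
    have "\<bar>4 * \<beta> * \<mu> * k * E\<bar> = 4 * \<bar>\<beta>\<bar> * \<bar>\<mu>\<bar> * k * E"
      using k \<open>E > 0\<close> by (simp add: abs_mult)
    also have "\<dots> \<le> 4 * M1 * \<nu> * k * 1"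
      using h assms \<nu> k \<open>E > 0\<close> \<open>E \<le> 1\<close> by (intro mult_mono) auto
    finally have q2: "\<bar>4 * \<beta> * \<mu> * k * E\<bar> \<le> 4 * M1 * \<nu> * k * 1" .
    have "\<mu>\<^sup>2 \<le> \<nu>\<^sup>2" using h(1) by (meson abs_le_square_iff abs_ge_self order_trans)
    also have "\<nu>\<^sup>2 \<le> \<nu>" using \<nu> by (simp add: power2_eq_square mult_left_le)
    finally have "\<mu>\<^sup>2 \<le> \<nu>" .
    have "\<bar>\<delta> * (2 - E) * \<mu>\<^sup>2 / r\<^sup>2\<bar> = \<delta> * (2 - E) * \<mu>\<^sup>2 / r\<^sup>2"
      using F h by (simp add: abs_mult)
    also have "\<dots> \<le> M1 * 2 * \<nu> / rs\<^sup>2"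
      using F h assms \<nu> \<open>\<mu>\<^sup>2 \<le> \<nu>\<close> by (intro frac_le mult_mono power_mono) auto
    finally have q3: "\<bar>\<delta> * (2 - E) * \<mu>\<^sup>2 / r\<^sup>2\<bar> \<le> M1 * 2 * \<nu> / rs\<^sup>2" .
    have "\<bar>b2 * (2 - E) * \<mu> / r\<bar> = \<bar>b2\<bar> * (2 - E) * \<bar>\<mu>\<bar> / r"
      using F \<open>r > 0\<close> by (simp add: abs_mult)
    also have "\<dots> \<le> M2 * 2 * \<nu> / rs"
      using F h assms \<nu> by (intro frac_le mult_mono) auto
    finally have q4: "\<bar>b2 * (2 - E) * \<mu> / r\<bar> \<le> M2 * 2 * \<nu> / rs" .
    have "2 * M1 * 2 * \<nu> / rs\<^sup>2 + 4 * M1 * \<nu> * k * 1 + M1 * 2 * \<nu> / rs\<^sup>2 + M2 * 2 * \<nu> / rs = \<nu> * K"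
      using assms by (simp add: K_def field_simps)
    moreover have "0 < P1 + P2 + (x1 + x2 - x3 + x4)"
      if "0 \<le> P1" "2 * m \<le> P2" "\<bar>x1\<bar> \<le> y1" "\<bar>x2\<bar> \<le> y2" "\<bar>x3\<bar> \<le> y3" "\<bar>x4\<bar> \<le> y4"
        "y1 + y2 + y3 + y4 = n" "n \<le> m" "0 < m"
      for P1 P2 x1 x2 x3 x4 y1 y2 y3 y4 m n :: real
      using that by linarith
    moreover have "2 * (k * rs * E0) \<le> 2 * k * r * E * (2 * k * r * \<alpha> - b1)"
      using p2 by (simp only: mult.assoc)
    ultimately show ?thesis
      unfolding split using p1 q1 q2 q3 q4 \<nu>K main0 by blast
  qed
  with that k(1) \<nu>(1) show thesis by blast
qed

text \<open>
  The contact condition is required in the parameter plane; the polar coordinates of the line through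
  the contact point depend continuously on $t$ and carry it over to the line.
\<close>

lemma barrier_contact:
  fixes u :: "real ^ 2 \<Rightarrow> real" and \<theta> r k R a c1 c2 \<mu>1 \<mu>2 :: real
    and A :: "real ^ 2 \<Rightarrow> real ^ 2 ^ 2" and b :: "real ^ 2 \<Rightarrow> real ^ 2"
  defines "G \<equiv> \<lambda>s \<tau>. a + c1 * barrier k R \<mu>1 s \<tau> + c2 * barrier k R \<mu>2 s \<tau>"
    and "x \<equiv> polar r \<theta>"
  assumes sym: "transpose (A x) = A x"
    and pos: "\<And>\<xi>. \<xi> \<bullet> (A x *v \<xi>) \<ge> c0 * (norm \<xi>)\<^sup>2" "c0 > 0"
    and r: "r > 0"
    and u: "\<forall>\<^sub>F z in nhds (r, \<theta>). u differentiable (at (polar (fst z) (snd z)))"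
    and u': "\<And>i. partial i u differentiable (at x)"
    and le: "\<forall>\<^sub>F z in nhds (r, \<theta>). u (polar (fst z) (snd z)) - G (fst z) (snd z) \<le> u x - G r \<theta>"
  defines "\<alpha> \<equiv> radial_dir \<theta> \<bullet> (A x *v radial_dir \<theta>)"
    and "\<beta> \<equiv> radial_dir \<theta> \<bullet> (A x *v angular_dir \<theta>)"
    and "\<delta> \<equiv> angular_dir \<theta> \<bullet> (A x *v angular_dir \<theta>)"
    and "b1 \<equiv> b x \<bullet> radial_dir \<theta>" and "b2 \<equiv> b x \<bullet> angular_dir \<theta>"
  shows "ell_op A b u x \<ge>
      c1 * (exp (\<mu>1 * \<theta>) * barrier_op k R \<mu>1 r \<alpha> \<beta> \<delta> b1 b2)
    + c2 * (exp (\<mu>2 * \<theta>) * barrier_op k R \<mu>2 r \<alpha> \<beta> \<delta> b1 b2)"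
proof -
  define E where "E = exp (k * (r\<^sup>2 - R\<^sup>2))"
  define path where "path = (\<lambda>p q t. (sqrt ((r + t * p)\<^sup>2 + (t * q)\<^sup>2), \<theta> + arctan (t * q / (r + t * p))))"
  have m: "\<forall>\<^sub>F t in nhds 0. r + t * p > 0" for p
  proof -
    have "((\<lambda>t. r + t * p) \<longlongrightarrow> r + 0 * p) (nhds 0)"
      by (intro tendsto_intros filterlim_ident)
    from order_tendstoD(1)[OF this, of 0] r show ?thesis by simp
  qed
  have "isCont (path p q) 0" for p q
    unfolding path_def using r by (intro continuous_intros) auto
  moreover have "path p q 0 = (r, \<theta>)" for p q using r by (simp add: path_def)
  ultimately have lim: "filterlim (path p q) (nhds (r, \<theta>)) (nhds 0)" for p q
    by (metis continuous_at tendsto_at_iff_tendsto_nhds)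
  define g where "g = (\<lambda>p q t. a + c1 * barrier_line k R \<mu>1 r \<theta> p q t + c2 * barrier_line k R \<mu>2 r \<theta> p q t)"
  define g' where "g' = (\<lambda>p q t. c1 * barrier_line' k R \<mu>1 r \<theta> p q t + c2 * barrier_line' k R \<mu>2 r \<theta> p q t)"
  have gG: "g p q t = G (fst (path p q t)) (snd (path p q t))" for p q t
    by (simp add: g_def G_def path_def barrier_line_def)
  have g0: "g p q 0 = G r \<theta>" for p q
    unfolding gG using \<open>\<And>p q. path p q 0 = (r, \<theta>)\<close> by simp
  define Q11 Q12 Q22 D1 D2 where Q:
    "Q11 = (\<lambda>\<mu>. exp (\<mu> * \<theta>) * (- 2 * k * E - 4 * k\<^sup>2 * r\<^sup>2 * E))"
    "Q12 = (\<lambda>\<mu>. exp (\<mu> * \<theta>) * (- (2 - E) * \<mu> / r\<^sup>2 - 2 * \<mu> * k * E))"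
    "Q22 = (\<lambda>\<mu>. exp (\<mu> * \<theta>) * ((2 - E) * \<mu>\<^sup>2 / r\<^sup>2 - 2 * k * E))"
    "D1 = (\<lambda>\<mu>. exp (\<mu> * \<theta>) * (- 2 * k * r * E))"
    "D2 = (\<lambda>\<mu>. exp (\<mu> * \<theta>) * (\<mu> / r * (2 - E)))"
  have main: "ell_op A b u x \<ge>
    - (\<alpha> * (c1 * Q11 \<mu>1 + c2 * Q11 \<mu>2) + 2 * \<beta> * (c1 * Q12 \<mu>1 + c2 * Q12 \<mu>2)
       + \<delta> * (c1 * Q22 \<mu>1 + c2 * Q22 \<mu>2))
    + b1 * (c1 * D1 \<mu>1 + c2 * D1 \<mu>2) + b2 * (c1 * D2 \<mu>1 + c2 * D2 \<mu>2)"
    unfolding \<alpha>_def \<beta>_def \<delta>_def b1_def b2_def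
  proof (rule ell_op_ge_at_contact[where G = g and G' = g' and ?c0.0 = c0])
    fix p q
    let ?\<xi> = "p *\<^sub>R radial_dir \<theta> + q *\<^sub>R angular_dir \<theta>"
    have "\<forall>\<^sub>F t in nhds 0. x + t *\<^sub>R ?\<xi> = polar (fst (path p q t)) (snd (path p q t))"
      using m[of p] by eventually_elim (simp add: x_def path_def polar_along_line)
    note on_path = this
    show "\<forall>\<^sub>F t in nhds 0. u differentiable (at (x + t *\<^sub>R ?\<xi>))"
      using on_path eventually_compose_filterlim[OF u lim] by eventually_elim simp
    show "\<forall>\<^sub>F t in nhds 0. (g p q has_real_derivative g' p q t) (at t)"
      using m[of p] unfolding g_def g'_def
      by eventually_elim (auto intro!: derivative_eq_intros barrier_line_derivative)
    show "(g' p q has_real_derivative (c1 * Q11 \<mu>1 + c2 * Q11 \<mu>2) * p\<^sup>2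
        + 2 * (c1 * Q12 \<mu>1 + c2 * Q12 \<mu>2) * p * q + (c1 * Q22 \<mu>1 + c2 * Q22 \<mu>2) * q\<^sup>2) (at 0)"
      unfolding g'_def
      by (rule DERIV_cong[OF DERIV_add[OF DERIV_cmult DERIV_cmult]],
          rule barrier_line_second_derivative[OF r], rule barrier_line_second_derivative[OF r])
        (simp only: Q E_def[symmetric] distrib_left distrib_right mult.assoc mult.left_commute add_ac)
    show "g' p q 0 = (c1 * D1 \<mu>1 + c2 * D1 \<mu>2) * p + (c1 * D2 \<mu>1 + c2 * D2 \<mu>2) * q"
      unfolding g'_def barrier_line'_0[OF r] Q E_def[symmetric]
      by (simp only: distrib_left distrib_right mult.assoc mult.left_commute add_ac)
    show "\<forall>\<^sub>F t in nhds 0. u (x + t *\<^sub>R ?\<xi>) - g p q t \<le> u x - g p q 0"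
      using on_path eventually_compose_filterlim[OF le lim]
      by eventually_elim (simp add: gG[symmetric] g0)
  qed (use sym pos u' in auto)
  have op_eq: "exp (\<mu> * \<theta>) * barrier_op k R \<mu> r \<alpha> \<beta> \<delta> b1 b2 =
     - (\<alpha> * Q11 \<mu> + 2 * \<beta> * Q12 \<mu> + \<delta> * Q22 \<mu>) + b1 * D1 \<mu> + b2 * D2 \<mu>" for \<mu>
  proof -
    have "e * (- (\<alpha> * q1 + 2 * \<beta> * q2 + \<delta> * q3) + b1 * d1 + b2 * d2) =
      - (\<alpha> * (e * q1) + 2 * \<beta> * (e * q2) + \<delta> * (e * q3)) + b1 * (e * d1) + b2 * (e * d2)" for e q1 q2 q3 d1 d2
      by algebra
    then show ?thesis by (simp only: barrier_op_def Let_def Q E_def[symmetric])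
  qed
  show ?thesis
    unfolding op_eq by (rule order_trans[OF _ main]) (simp add: algebra_simps)
qed

section \<open>Comparison on the spiral strip\<close>

lemma barrier_bounds:
  assumes "0 \<le> k" "0 \<le> r" "r \<le> R"
  shows "exp (\<mu> * \<theta>) \<le> barrier k R \<mu> r \<theta>" "barrier k R \<mu> r \<theta> \<le> 2 * exp (\<mu> * \<theta>)"
proof -
  have "r\<^sup>2 - R\<^sup>2 \<le> 0" using assms by (simp add: power_mono)
  then have "exp (k * (r\<^sup>2 - R\<^sup>2)) \<le> 1" using assms by (simp add: mult_nonneg_nonpos)
  then have "exp (\<mu> * \<theta>) * 1 \<le> barrier k R \<mu> r \<theta>"
    unfolding barrier_def by (intro mult_left_mono) auto
  then show "exp (\<mu> * \<theta>) \<le> barrier k R \<mu> r \<theta>" by simp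
  have "barrier k R \<mu> r \<theta> \<le> exp (\<mu> * \<theta>) * 2"
    unfolding barrier_def by (intro mult_left_mono) auto
  then show "barrier k R \<mu> r \<theta> \<le> 2 * exp (\<mu> * \<theta>)" by simp
qed

locale spiral_operator =
  fixes \<theta>0 rs c0 M1 M2 :: real
    and r1 r2 :: "real \<Rightarrow> real"
    and A :: "real ^ 2 \<Rightarrow> real ^ 2 ^ 2"
    and b :: "real ^ 2 \<Rightarrow> real ^ 2"
  assumes cont_r1: "continuous_on {\<theta>0..} r1" and cont_r2: "continuous_on {\<theta>0..} r2"
    and nested: "\<And>\<theta>. \<theta> \<ge> \<theta>0 \<Longrightarrow> r2 (\<theta> + 2 * pi) < r1 \<theta> \<and> r1 \<theta> < r2 \<theta>"
    and rs_pos: "rs > 0" and lim_r1: "(r1 \<longlongrightarrow> rs) at_top" and lim_r2: "(r2 \<longlongrightarrow> rs) at_top"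
    and A_sym: "\<And>x. x \<in> spiral_dom \<theta>0 r1 r2 \<Longrightarrow> transpose (A x) = A x"
    and c0_pos: "c0 > 0" and M2_nonneg: "M2 \<ge> 0"
    and A_elliptic: "\<And>x \<xi>. x \<in> spiral_dom \<theta>0 r1 r2 \<Longrightarrow> \<xi> \<bullet> (A x *v \<xi>) \<ge> c0 * (norm \<xi>)\<^sup>2"
    and A_trace: "\<And>x. x \<in> spiral_dom \<theta>0 r1 r2 \<Longrightarrow> trace (A x) \<le> M1"
    and b_bound: "\<And>x. x \<in> spiral_dom \<theta>0 r1 r2 \<Longrightarrow> norm (b x) \<le> M2"
begin

text \<open>
  Along one turn the strip moves inwards, so $r_1(\theta+2\pi n)$ decreases to its limit.
\<close>

lemma r1_lower: assumes "\<theta> \<ge> \<theta>0" shows "rs \<le> r1 \<theta>"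
proof -
  define f where "f = (\<lambda>n. r1 (\<theta> + 2 * pi * real n))"
  have "decseq f"
  proof (rule decseq_SucI)
    fix n
    define \<phi> where "\<phi> = \<theta> + 2 * pi * real n"
    have "\<phi> \<ge> \<theta>0" using assms by (simp add: \<phi>_def add_increasing2)
    then have "r1 (\<phi> + 2 * pi) \<le> r1 \<phi>" using nested[of \<phi>] nested[of "\<phi> + 2 * pi"] pi_gt_zero by (smt (verit))
    then show "f (Suc n) \<le> f n" by (simp add: f_def \<phi>_def algebra_simps)
  qed
  moreover have "filterlim (\<lambda>n. \<theta> + 2 * pi * real n) at_top sequentially"
    by (intro filterlim_tendsto_add_at_top[OF tendsto_const]
        filterlim_tendsto_pos_mult_at_top[OF tendsto_const] filterlim_real_sequentially) simp
  then have "f \<longlonglongrightarrow> rs" unfolding f_def by (rule filterlim_compose[OF lim_r1])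
  ultimately have "rs \<le> f 0" by (rule decseq_ge)
  then show ?thesis by (simp add: f_def)
qed

lemma r2_upper: obtains R where "\<And>\<theta>. \<theta> \<ge> \<theta>0 \<Longrightarrow> r2 \<theta> \<le> R"
proof -
  have "\<forall>\<^sub>F \<theta> in at_top. r2 \<theta> < rs + 1"
    using lim_r2 by (rule order_tendstoD) simp
  then obtain T where T: "\<And>\<theta>. \<theta> \<ge> T \<Longrightarrow> r2 \<theta> < rs + 1"
    unfolding eventually_at_top_linorder by blast
  have "compact (r2 ` {\<theta>0..T})"
    by (intro compact_continuous_image continuous_on_subset[OF cont_r2]) auto
  then obtain B where B: "\<And>\<theta>. \<theta>0 \<le> \<theta> \<Longrightarrow> \<theta> \<le> T \<Longrightarrow> r2 \<theta> \<le> B"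
    using compact_imp_bounded bounded_imp_bdd_above unfolding bdd_above_def by fastforce
  show thesis
  proof (rule that)
    fix \<theta> assume "\<theta> \<ge> \<theta>0"
    then show "r2 \<theta> \<le> max B (rs + 1)" using T[of \<theta>] B[of \<theta>] by linarith
  qed
qed

lemma polar_in_ext: "\<theta>0 \<le> \<theta> \<Longrightarrow> r1 \<theta> \<le> r \<Longrightarrow> r \<le> r2 \<theta> \<Longrightarrow> polar r \<theta> \<in> spiral_ext \<theta>0 r1 r2"
  unfolding spiral_ext_def by blast

lemma polar_in_dom: "\<theta>0 < \<theta> \<Longrightarrow> r1 \<theta> < r \<Longrightarrow> r < r2 \<theta> \<Longrightarrow> polar r \<theta> \<in> spiral_dom \<theta>0 r1 r2"
  unfolding spiral_dom_def by blast

text \<open>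
  The diagonal entries are nonnegative with sum $\mathrm{Tr}\,A$. Applying the positive quadratic form
  to $e\pm\tau$ bounds the off-diagonal entry by half of the trace.
\<close>

lemma frame_coefficient_bounds:
  fixes \<theta> :: real
  assumes x: "x \<in> spiral_dom \<theta>0 r1 r2"
  defines "\<alpha> \<equiv> radial_dir \<theta> \<bullet> (A x *v radial_dir \<theta>)"
    and "\<beta> \<equiv> radial_dir \<theta> \<bullet> (A x *v angular_dir \<theta>)"
    and "\<delta> \<equiv> angular_dir \<theta> \<bullet> (A x *v angular_dir \<theta>)"
  shows "c0 \<le> \<alpha>" "0 \<le> \<delta>" "\<delta> \<le> M1" "\<bar>\<beta>\<bar> \<le> M1"
    "\<bar>b x \<bullet> radial_dir \<theta>\<bar> \<le> M2" "\<bar>b x \<bullet> angular_dir \<theta>\<bar> \<le> M2"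
proof -
  have a21: "A x $ 2 $ 1 = A x $ 1 $ 2"
    using arg_cong[OF A_sym[OF x], of "\<lambda>B. B $ 1 $ 2"] by (simp add: transpose_def)
  have \<beta>2: "angular_dir \<theta> \<bullet> (A x *v radial_dir \<theta>) = \<beta>"
    unfolding \<beta>_def by (metis dot_lmul_matrix inner_commute A_sym[OF x] transpose_matrix_vector)
  have nn: "0 \<le> \<xi> \<bullet> (A x *v \<xi>)" for \<xi>
    using A_elliptic[OF x, of \<xi>] c0_pos by (meson less_imp_le mult_nonneg_nonneg order_trans zero_le_power2)
  show \<alpha>: "c0 \<le> \<alpha>" using A_elliptic[OF x, of "radial_dir \<theta>"] by (simp add: power2_norm_eq_inner \<alpha>_def)
  show \<delta>: "0 \<le> \<delta>" unfolding \<delta>_def by (rule nn)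
  have "\<alpha> + \<delta> = A x $ 1 $ 1 * ((sin \<theta>)\<^sup>2 + (cos \<theta>)\<^sup>2) + A x $ 2 $ 2 * ((sin \<theta>)\<^sup>2 + (cos \<theta>)\<^sup>2)"
    unfolding \<alpha>_def \<delta>_def frame_quadratic_form[OF a21] by (simp only: algebra_simps)
  also have "\<dots> = trace (A x)" by (simp only: sin_cos_squared_add) (simp add: trace_def sum_2)
  finally have tr: "\<alpha> + \<delta> \<le> M1" using A_trace[OF x] by simp
  show "\<delta> \<le> M1" using tr \<alpha> c0_pos by simp
  have "0 \<le> \<alpha> + 2 * \<beta> + \<delta>"
    using nn[of "radial_dir \<theta> + angular_dir \<theta>"]
    by (simp add: matrix_vector_right_distrib inner_add_left inner_add_right \<beta>2 flip: \<alpha>_def \<beta>_def \<delta>_def)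
  moreover have "0 \<le> \<alpha> - 2 * \<beta> + \<delta>"
    using nn[of "radial_dir \<theta> - angular_dir \<theta>"]
    by (simp add: matrix_vector_mult_diff_distrib inner_diff_left inner_diff_right \<beta>2 flip: \<alpha>_def \<beta>_def \<delta>_def)
  ultimately show "\<bar>\<beta>\<bar> \<le> M1" using tr \<alpha> \<delta> c0_pos by linarith
  have "\<bar>b x \<bullet> e\<bar> \<le> M2" if "e \<bullet> e = 1" for e
    using Cauchy_Schwarz_ineq2[of "b x" e] b_bound[OF x] that by (simp add: norm_eq_sqrt_inner[of e])
  then show "\<bar>b x \<bullet> radial_dir \<theta>\<bar> \<le> M2" "\<bar>b x \<bullet> angular_dir \<theta>\<bar> \<le> M2" by simp_all
qed

text \<open>
  The parameter region is the image of a rectangle under linear interpolation between the two radii.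
\<close>

lemma compact_truncation:
  assumes "\<theta>0 \<le> \<theta>1"
  shows "compact {z. \<theta>1 \<le> snd z \<and> snd z \<le> T \<and> r1 (snd z) \<le> fst z \<and> fst z \<le> r2 (snd z)}" (is "compact ?K")
proof -
  define \<Phi> where "\<Phi> = (\<lambda>z. (r1 (snd z) + fst z * (r2 (snd z) - r1 (snd z)), snd z))"
  have "continuous_on ({0..1} \<times> {\<theta>1..T}) \<Phi>"
    unfolding \<Phi>_def using assms
    by (intro continuous_intros continuous_on_compose2[OF cont_r1] continuous_on_compose2[OF cont_r2]) auto
  then have "compact (\<Phi> ` ({0..1} \<times> {\<theta>1..T}))"
    by (intro compact_continuous_image compact_Times) auto
  also have "\<Phi> ` ({0..1} \<times> {\<theta>1..T}) = ?K"
  proof (intro set_eqI iffI)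
    fix z assume "z \<in> \<Phi> ` ({0..1} \<times> {\<theta>1..T})"
    then obtain s \<tau> where s: "0 \<le> s" "s \<le> 1" "\<theta>1 \<le> \<tau>" "\<tau> \<le> T" "z = (r1 \<tau> + s * (r2 \<tau> - r1 \<tau>), \<tau>)"
      by (auto simp: \<Phi>_def)
    have "0 \<le> r2 \<tau> - r1 \<tau>" using nested[of \<tau>] assms s by simp
    then have "0 \<le> s * (r2 \<tau> - r1 \<tau>)" "s * (r2 \<tau> - r1 \<tau>) \<le> r2 \<tau> - r1 \<tau>"
      using s by (simp_all only: mult_left_le_one_le mult_nonneg_nonneg)
    then show "z \<in> ?K" using s by auto
  next
    fix z assume z: "z \<in> ?K"
    define \<tau> s where "\<tau> = snd z" and "s = (fst z - r1 \<tau>) / (r2 \<tau> - r1 \<tau>)"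
    have w: "0 < r2 \<tau> - r1 \<tau>" using nested[of \<tau>] assms z by (simp add: \<tau>_def)
    then have "z = \<Phi> (s, \<tau>)" by (simp add: \<Phi>_def s_def prod_eq_iff \<tau>_def)
    moreover have "0 \<le> s" "s \<le> 1" using w z by (simp_all add: s_def \<tau>_def)
    ultimately show "z \<in> \<Phi> ` ({0..1} \<times> {\<theta>1..T})" using z by (auto simp: \<tau>_def)
  qed
  finally show ?thesis .
qed

lemma continuous_on_polar: "continuous_on S (\<lambda>z. polar (fst z) (snd z))"
proof -
  have eq: "(\<lambda>z. polar (fst z) (snd z)) = (\<lambda>z. (fst z * cos (snd z)) *\<^sub>R axis 1 1 + (fst z * sin (snd z)) *\<^sub>R axis 2 1)"
    by (simp add: fun_eq_iff polar_def vec_eq_iff forall_2 axis_def)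
  show ?thesis unfolding eq by (intro continuous_intros)
qed

lemma interior_parameters:
  assumes "\<theta>0 < \<tau>" "r1 \<tau> < r" "r < r2 \<tau>" "\<theta>1 < \<tau>" "\<tau> < T"
  shows "\<forall>\<^sub>F z in nhds (r, \<tau>). \<theta>0 < snd z \<and> \<theta>1 < snd z \<and> snd z < T \<and> r1 (snd z) < fst z \<and> fst z < r2 (snd z)"
proof -
  have iso: "isCont f \<tau>" if "continuous_on {\<theta>0..} f" for f :: "real \<Rightarrow> real"
    using that assms(1) by (intro continuous_on_interior[of "{\<theta>0..}"]) auto
  have s: "((\<lambda>z. snd z) \<longlongrightarrow> \<tau>) (nhds (r, \<tau>))"
    using tendsto_snd[OF filterlim_ident, of "(r, \<tau>)"] by simp
  have f: "((\<lambda>z. fst z) \<longlongrightarrow> r) (nhds (r, \<tau>))"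
    using tendsto_fst[OF filterlim_ident, of "(r, \<tau>)"] by simp
  have 1: "((\<lambda>z. fst z - r1 (snd z)) \<longlongrightarrow> r - r1 \<tau>) (nhds (r, \<tau>))"
    by (intro tendsto_diff f isCont_tendsto_compose[OF iso[OF cont_r1] s])
  have 2: "((\<lambda>z. r2 (snd z) - fst z) \<longlongrightarrow> r2 \<tau> - r) (nhds (r, \<tau>))"
    by (intro tendsto_diff f isCont_tendsto_compose[OF iso[OF cont_r2] s])
  have "0 < r - r1 \<tau>" "0 < r2 \<tau> - r" using assms by auto
  note ev = order_tendstoD(1)[OF s assms(1)] order_tendstoD(1)[OF s assms(4)] order_tendstoD(2)[OF s assms(5)]
      order_tendstoD(1)[OF 1 this(1)] order_tendstoD(1)[OF 2 this(2)]
  then show ?thesis by eventually_elim simp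
qed

text \<open>
  A single far-away cross-section on which $u$ is dominated by the growing barrier is enough to close
  off the strip. Half of $\varepsilon e^{\nu T}$ is spent on $u$ and half on the constant $a$, which may be
  negative.
\<close>

lemma growth_section_bound:
  assumes g: "below_exp_growth r1 r2 u" and "\<nu> > 0" "\<epsilon> > 0"
  shows "\<exists>T\<ge>\<theta>. \<forall>r. r1 T \<le> r \<and> r \<le> r2 T \<longrightarrow> u (polar r T) \<le> a + \<epsilon> * exp (\<nu> * T)"
proof -
  have "((\<lambda>\<theta>. ereal (exp (- \<nu> * \<theta>)) * (SUP x\<in>cross_section r1 r2 \<theta>. ereal \<bar>u x\<bar>)) \<longlongrightarrow> 0) at_top"
    using g \<open>\<nu> > 0\<close> unfolding below_exp_growth_def by blast
  then have "\<forall>\<^sub>F \<theta> in at_top. ereal (exp (- \<nu> * \<theta>)) * (SUP x\<in>cross_section r1 r2 \<theta>. ereal \<bar>u x\<bar>) < ereal (\<epsilon> / 2)"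
    using \<open>\<epsilon> > 0\<close> by (intro order_tendstoD(2)) auto
  then have "\<forall>\<^sub>F T in at_top. max \<theta> (- 2 * a / (\<epsilon> * \<nu>)) \<le> T \<and>
      ereal (exp (- \<nu> * T)) * (SUP x\<in>cross_section r1 r2 T. ereal \<bar>u x\<bar>) < ereal (\<epsilon> / 2)"
    by (rule eventually_conj[OF eventually_ge_at_top])
  then obtain T where T: "\<theta> \<le> T" "- 2 * a / (\<epsilon> * \<nu>) \<le> T"
      "ereal (exp (- \<nu> * T)) * (SUP x\<in>cross_section r1 r2 T. ereal \<bar>u x\<bar>) < ereal (\<epsilon> / 2)"
    using eventually_happens'[OF trivial_limit_at_top_linorder] by fastforce
  have "u (polar r T) \<le> a + \<epsilon> * exp (\<nu> * T)" if r: "r1 T \<le> r" "r \<le> r2 T" for r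
  proof -
    have "polar r T \<in> cross_section r1 r2 T" using r by (auto simp: cross_section_def)
    then have "ereal \<bar>u (polar r T)\<bar> \<le> (SUP x\<in>cross_section r1 r2 T. ereal \<bar>u x\<bar>)" by (rule SUP_upper)
    then have "ereal (exp (- \<nu> * T)) * ereal \<bar>u (polar r T)\<bar>
        \<le> ereal (exp (- \<nu> * T)) * (SUP x\<in>cross_section r1 r2 T. ereal \<bar>u x\<bar>)"
      by (intro ereal_mult_left_mono) auto
    with T(3) have "exp (- \<nu> * T) * \<bar>u (polar r T)\<bar> < \<epsilon> / 2" by (metis order_le_less_trans ereal_less(1) less_ereal.simps(1) times_ereal.simps(1))
    then have u: "\<bar>u (polar r T)\<bar> < \<epsilon> / 2 * exp (\<nu> * T)"
      by (simp add: exp_minus field_simps)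
    have "- 2 * a \<le> T * (\<epsilon> * \<nu>)" using T(2) mult_pos_pos[OF assms(3,2)] by (simp only: pos_divide_le_eq)
    then have "- a \<le> \<epsilon> / 2 * (\<nu> * T)" by (simp add: algebra_simps)
    also have "\<nu> * T \<le> exp (\<nu> * T)" using exp_ge_add_one_self[of "\<nu> * T"] by linarith
    then have "\<epsilon> / 2 * (\<nu> * T) \<le> \<epsilon> / 2 * exp (\<nu> * T)"
      using \<open>\<epsilon> > 0\<close> by (intro mult_left_mono) auto
    finally show ?thesis using u by linarith
  qed
  with T(1) show ?thesis by blast
qed

text \<open>
  The strip is cut off at an angle $T$ where $\varepsilon w_\nu$ dominates. A positive maximum of
  $u-a-c\,w_{-\nu}-\varepsilon w_\nu$ over the compact remainder cannot lie on its boundary, and in the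
  interior it would force $Lu \ge c\,Lw_{-\nu}+\varepsilon Lw_\nu > 0$. Finally $\varepsilon\to0$.
\<close>

lemma comparison:
  assumes u: "C2_on (spiral_dom \<theta>0 r1 r2) u" "continuous_on (spiral_ext \<theta>0 r1 r2) u"
    "below_exp_growth r1 r2 u"
    and Lu: "\<And>x. x \<in> spiral_dom \<theta>0 r1 r2 \<Longrightarrow> ell_op A b u x \<le> 0"
    and k: "0 \<le> k" "0 < \<nu>" and R: "\<And>\<theta>. \<theta> \<ge> \<theta>0 \<Longrightarrow> r2 \<theta> \<le> R"
    and op: "\<And>\<mu> r \<alpha> \<beta> \<delta> b1 b2. \<lbrakk>\<bar>\<mu>\<bar> \<le> \<nu>; rs \<le> r; r \<le> R; c0 \<le> \<alpha>; 0 \<le> \<delta>; \<delta> \<le> M1; \<bar>\<beta>\<bar> \<le> M1;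
       \<bar>b1\<bar> \<le> M2; \<bar>b2\<bar> \<le> M2\<rbrakk> \<Longrightarrow> 0 < barrier_op k R \<mu> r \<alpha> \<beta> \<delta> b1 b2"
    and \<theta>1: "\<theta>0 \<le> \<theta>1" and c: "0 \<le> c"
    and side: "\<And>\<theta> r. \<theta>1 \<le> \<theta> \<Longrightarrow> r = r1 \<theta> \<or> r = r2 \<theta> \<Longrightarrow> u (polar r \<theta>) \<le> a + c * barrier k R (- \<nu>) r \<theta>"
    and base: "\<And>r. r1 \<theta>1 \<le> r \<Longrightarrow> r \<le> r2 \<theta>1 \<Longrightarrow> u (polar r \<theta>1) \<le> a + c * barrier k R (- \<nu>) r \<theta>1"
    and \<theta>: "\<theta>1 \<le> \<theta>" and r: "r1 \<theta> \<le> r" "r \<le> r2 \<theta>"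
  shows "u (polar r \<theta>) \<le> a + c * barrier k R (- \<nu>) r \<theta>"
proof -
  have rpos: "0 < r" if "\<theta>0 \<le> \<theta>" "r1 \<theta> \<le> r" for r \<theta>
    using r1_lower[OF that(1)] that(2) rs_pos by linarith
  have eps: "u (polar r \<theta>) \<le> a + c * barrier k R (- \<nu>) r \<theta> + \<epsilon> * barrier k R \<nu> r \<theta>" if epos: "\<epsilon> > 0" for \<epsilon>
  proof -
    obtain T where "\<theta> \<le> T" and T: "\<And>r. r1 T \<le> r \<Longrightarrow> r \<le> r2 T \<Longrightarrow> u (polar r T) \<le> a + \<epsilon> * exp (\<nu> * T)"
      using growth_section_bound[OF u(3) k(2) epos] by metis
    define G where "G = (\<lambda>s \<tau>. a + c * barrier k R (- \<nu>) s \<tau> + \<epsilon> * barrier k R \<nu> s \<tau>)"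
    define V where "V = (\<lambda>z. u (polar (fst z) (snd z)) - G (fst z) (snd z))"
    define K where "K = {z. \<theta>1 \<le> snd z \<and> snd z \<le> T \<and> r1 (snd z) \<le> fst z \<and> fst z \<le> r2 (snd z)}"
    have "continuous_on K V"
      unfolding V_def G_def barrier_def using \<theta>1
      by (intro continuous_intros continuous_on_compose2[OF u(2) continuous_on_polar])
        (auto simp: K_def intro!: polar_in_ext)
    moreover have "(r, \<theta>) \<in> K" using \<theta> r \<open>\<theta> \<le> T\<close> by (simp add: K_def)
    moreover have "compact K" unfolding K_def by (rule compact_truncation[OF \<theta>1])
    ultimately obtain z where z: "z \<in> K" and zmax: "\<And>y. y \<in> K \<Longrightarrow> V y \<le> V z"
      using continuous_attains_sup[of K V] by blast
    obtain s \<tau> where st: "z = (s, \<tau>)" by (cases z)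
    have s: "\<theta>1 \<le> \<tau>" "\<tau> \<le> T" "r1 \<tau> \<le> s" "s \<le> r2 \<tau>" using z by (simp_all add: K_def st)
    have s': "\<theta>0 \<le> \<tau>" "0 < s" "s \<le> R" "rs \<le> s"
      using s \<theta>1 rpos[of \<tau> s] R[of \<tau>] r1_lower[of \<tau>] by auto
    have lower: "exp (\<mu> * \<tau>) \<le> barrier k R \<mu> s \<tau>" for \<mu>
      using barrier_bounds(1)[of k s R] k s' by simp
    have pos: "0 \<le> c * barrier k R (- \<nu>) s \<tau>" "exp (\<nu> * \<tau>) \<le> barrier k R \<nu> s \<tau>" "0 < exp (\<nu> * \<tau>)"
      using mult_nonneg_nonneg[OF c order_trans[OF exp_ge_zero lower]] lower by auto
    have eb: "0 < \<epsilon> * barrier k R \<nu> s \<tau>" using pos epos by (intro mult_pos_pos) linarith+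
    have "V z \<le> 0"
    proof (rule ccontr)
      assume "\<not> V z \<le> 0"
      then have V: "G s \<tau> < u (polar s \<tau>)" by (simp add: V_def st)
      have "\<tau> \<noteq> \<theta>1" using base[of s] s V eb by (auto simp: G_def)
      moreover have "s \<noteq> r1 \<tau>" "s \<noteq> r2 \<tau>" using side[of \<tau> s] s V eb by (auto simp: G_def)
      moreover have "\<tau> \<noteq> T"
      proof
        assume "\<tau> = T"
        then have "u (polar s \<tau>) \<le> a + \<epsilon> * exp (\<nu> * \<tau>)" using T s by simp
        also have "\<dots> \<le> G s \<tau>" unfolding G_def using pos(1) mult_left_mono[OF pos(2) less_imp_le[OF epos]] by linarith
        finally show False using V by simp
      qed
      ultimately have int: "\<theta>0 < \<tau>" "r1 \<tau> < s" "s < r2 \<tau>" "\<theta>1 < \<tau>" "\<tau> < T" using s \<theta>1 by auto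
      note near = interior_parameters[OF int]
      define x where "x = polar s \<tau>"
      have x: "x \<in> spiral_dom \<theta>0 r1 r2" unfolding x_def using int by (intro polar_in_dom)
      have e1: "\<forall>\<^sub>F z in nhds (s, \<tau>). u differentiable (at (polar (fst z) (snd z)))"
        using near by eventually_elim (use u(1) polar_in_dom in \<open>auto simp: C2_on_def\<close>)
      have e2: "\<forall>\<^sub>F z in nhds (s, \<tau>). u (polar (fst z) (snd z)) - G (fst z) (snd z) \<le> u (polar s \<tau>) - G s \<tau>"
        using near
      proof eventually_elim
        case (elim y)
        then have "y \<in> K" by (simp add: K_def)
        then show ?case using zmax[of y] by (simp add: V_def st)
      qed
      have e3: "partial i u differentiable (at (polar s \<tau>))" for i
        using u(1) x by (simp add: C2_on_def x_def)
      have xs: "transpose (A (polar s \<tau>)) = A (polar s \<tau>)" "\<And>\<xi>. c0 * (norm \<xi>)\<^sup>2 \<le> \<xi> \<bullet> (A (polar s \<tau>) *v \<xi>)"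
        using A_sym[OF x] A_elliptic[OF x] by (simp_all add: x_def)
      define op where "op = (\<lambda>\<mu>. barrier_op k R \<mu> s (radial_dir \<tau> \<bullet> (A x *v radial_dir \<tau>))
          (radial_dir \<tau> \<bullet> (A x *v angular_dir \<tau>)) (angular_dir \<tau> \<bullet> (A x *v angular_dir \<tau>))
          (b x \<bullet> radial_dir \<tau>) (b x \<bullet> angular_dir \<tau>))"
      have "0 < op \<mu>" if "\<bar>\<mu>\<bar> \<le> \<nu>" for \<mu>
        unfolding op_def using that s' frame_coefficient_bounds[OF x, of \<tau>] by (intro assms(8)) auto
      then have "0 < op (- \<nu>)" "0 < op \<nu>" using k by auto
      then have "0 < c * (exp (- \<nu> * \<tau>) * op (- \<nu>)) + \<epsilon> * (exp (\<nu> * \<tau>) * op \<nu>)"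
        using c epos by (intro add_nonneg_pos mult_nonneg_nonneg mult_pos_pos) auto
      also have "\<dots> \<le> ell_op A b u x"
        unfolding op_def x_def
        by (rule barrier_contact[where A = A and b = b and u = u and r = s and \<theta> = \<tau> and a = a and k = k and R = R
              and ?c1.0 = c and ?c2.0 = \<epsilon> and ?\<mu>1.0 = "- \<nu>" and ?\<mu>2.0 = \<nu>,
              OF xs c0_pos \<open>0 < s\<close> e1 e3 e2[unfolded G_def]])
      finally show False using Lu[OF x] by simp
    qed
    then have "V (r, \<theta>) \<le> 0" using zmax[OF \<open>(r, \<theta>) \<in> K\<close>] by simp
    then show ?thesis by (simp add: V_def G_def)
  qed
  have B: "0 < barrier k R \<nu> r \<theta>"
    using barrier_bounds(1)[of k r R \<nu> \<theta>] k rpos[of \<theta> r] \<theta> \<theta>1 r R[of \<theta>]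
    by (smt (verit) exp_gt_zero)
  show ?thesis
  proof (rule field_le_epsilon)
    fix e :: real assume "e > 0"
    then show "u (polar r \<theta>) \<le> a + c * barrier k R (- \<nu>) r \<theta> + e"
      using eps[of "e / barrier k R \<nu> r \<theta>"] B by simp
  qed
qed

end

section \<open>Passing to the negative function\<close>

lemma partial_uminus:
  assumes "u differentiable (at x)"
  shows "partial i (\<lambda>x. - u x) x = - partial i u x"
proof -
  have "(u has_derivative frechet_derivative u (at x)) (at x)"
    using assms frechet_derivative_works by blast
  then have "frechet_derivative (\<lambda>x. - u x) (at x) = (\<lambda>h. - frechet_derivative u (at x) h)"
    using frechet_derivative_at[OF has_derivative_minus] by metis
  then show ?thesis by (simp add: partial_def)
qed

text \<open>
  The derivative of $-u$ is an unspecified value where $u$ is not differentiable, so the first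
  partial derivatives of $u$ and $-u$ are opposite only on $U$. Openness of $U$ is what allows differentiating
  this identity once more.
\<close>

lemma second_partial_uminus:
  assumes U: "open U" "x \<in> U" and u: "C2_on U u"
  shows "partial i (\<lambda>x. - u x) differentiable (at x)"
    and "partial i (partial j (\<lambda>x. - u x)) x = - partial i (partial j u) x"
proof -
  have eq: "\<And>j y. y \<in> U \<Longrightarrow> - partial j u y = partial j (\<lambda>x. - u x) y"
    using u by (auto simp: C2_on_def partial_uminus)
  have d: "(\<lambda>y. - partial j u y) differentiable (at x)" "partial j u differentiable (at x)" for j
    using u U by (auto simp: C2_on_def)
  obtain D where "((\<lambda>y. - partial i u y) has_derivative D) (at x)"
    using d(1) unfolding differentiable_def by blast
  then have "(partial i (\<lambda>x. - u x) has_derivative D) (at x)"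
    by (rule has_derivative_transform_within_open[OF _ U eq])
  then show "partial i (\<lambda>x. - u x) differentiable (at x)" unfolding differentiable_def by blast
  have "frechet_derivative (\<lambda>y. - partial j u y) (at x) = frechet_derivative (partial j (\<lambda>x. - u x)) (at x)"
    by (rule frechet_derivative_transform_within_open[OF d(1) U eq])
  then show "partial i (partial j (\<lambda>x. - u x)) x = - partial i (partial j u) x"
    using partial_uminus[OF d(2)[of j], of i] by (simp add: partial_def)
qed

lemma C2_on_uminus:
  assumes "open U" "C2_on U u"
  shows "C2_on U (\<lambda>x. - u x)"
proof -
  have "continuous_on U (partial i (partial j (\<lambda>x. - u x)))" for i j
  proof (rule continuous_on_eq)
    show "continuous_on U (\<lambda>x. - partial i (partial j u) x)"
      using assms(2) by (simp add: C2_on_def continuous_on_minus)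
  qed (simp add: second_partial_uminus(2)[OF assms(1) _ assms(2)])
  with second_partial_uminus(1)[OF assms(1) _ assms(2)] show ?thesis
    using assms(2) by (simp add: C2_on_def)
qed

lemma ell_op_uminus:
  assumes "open U" "x \<in> U" "C2_on U u"
  shows "ell_op A b (\<lambda>x. - u x) x = - ell_op A b u x"
proof -
  have "grad (\<lambda>x. - u x) x = - grad u x"
    using assms by (simp add: vec_eq_iff grad_def partial_uminus C2_on_def)
  then show ?thesis
    by (simp add: ell_op_def second_partial_uminus(2)[OF assms] sum_negf)
qed

context spiral_operator
begin

text \<open>
  Near a point of the domain the plane is parametrized by continuous polar coordinates: write $y-x$ in
  the polar frame at $x$ and follow the segment from $x$ to $y$. The coordinates of points close to $x$ are
  then close to those of $x$ and satisfy the same strict inequalities.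
\<close>

lemma open_spiral_dom: "open (spiral_dom \<theta>0 r1 r2)"
proof (subst open_subopen, intro ballI)
  fix x assume "x \<in> spiral_dom \<theta>0 r1 r2"
  then obtain r \<theta> where x: "x = polar r \<theta>" "\<theta>0 < \<theta>" "r1 \<theta> < r" "r < r2 \<theta>"
    by (auto simp: spiral_dom_def)
  have r: "0 < r" using r1_lower[of \<theta>] x rs_pos by simp
  define p q where "p = (\<lambda>y. (y - x) \<bullet> radial_dir \<theta>)" and "q = (\<lambda>y. (y - x) \<bullet> angular_dir \<theta>)"
  define \<Psi> where "\<Psi> = (\<lambda>y. (sqrt ((r + p y)\<^sup>2 + (q y)\<^sup>2), \<theta> + arctan (q y / (r + p y))))"
  have "isCont \<Psi> x" unfolding \<Psi>_def p_def q_def using r by (intro continuous_intros) auto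
  moreover have "\<Psi> x = (r, \<theta>)" using r by (simp add: \<Psi>_def p_def q_def)
  ultimately have \<Psi>: "filterlim \<Psi> (nhds (r, \<theta>)) (nhds x)"
    by (metis continuous_at tendsto_at_iff_tendsto_nhds)
  have "((\<lambda>y. r + p y) \<longlongrightarrow> r + (x - x) \<bullet> radial_dir \<theta>) (nhds x)"
    unfolding p_def by (intro tendsto_intros filterlim_ident)
  then have "\<forall>\<^sub>F y in nhds x. 0 < r + p y" using r by (intro order_tendstoD(1)) auto
  moreover have "\<forall>\<^sub>F y in nhds x. \<theta>0 < snd (\<Psi> y) \<and> \<theta> - 1 < snd (\<Psi> y) \<and> snd (\<Psi> y) < \<theta> + 1 \<and>
      r1 (snd (\<Psi> y)) < fst (\<Psi> y) \<and> fst (\<Psi> y) < r2 (snd (\<Psi> y))"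
    by (rule eventually_compose_filterlim[OF interior_parameters \<Psi>]) (use x in auto)
  ultimately have "\<forall>\<^sub>F y in nhds x. y \<in> spiral_dom \<theta>0 r1 r2"
  proof eventually_elim
    case (elim y)
    have "y = x + 1 *\<^sub>R (p y *\<^sub>R radial_dir \<theta> + q y *\<^sub>R angular_dir \<theta>)"
      unfolding p_def q_def using frame_expansion[of "y - x" \<theta>] by (simp add: algebra_simps)
    also have "\<dots> = polar (fst (\<Psi> y)) (snd (\<Psi> y))"
      unfolding x(1) using polar_along_line[of r 1 "p y" \<theta> "q y"] elim by (simp add: \<Psi>_def)
    finally show ?case using polar_in_dom elim by metis
  qed
  then show "\<exists>T. open T \<and> x \<in> T \<and> T \<subseteq> spiral_dom \<theta>0 r1 r2"
    unfolding eventually_nhds by blast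
qed

section \<open>Estimates for sub- and supersolutions\<close>

definition subsolution_class :: "(real ^ 2 \<Rightarrow> real) \<Rightarrow> bool" where
  "subsolution_class u \<longleftrightarrow> C2_on (spiral_dom \<theta>0 r1 r2) u \<and> continuous_on (spiral_ext \<theta>0 r1 r2) u \<and>
     below_exp_growth r1 r2 u \<and> (\<forall>x\<in>spiral_dom \<theta>0 r1 r2. ell_op A b u x \<le> 0)"

text \<open>
  The initial angle $\theta_1$ is quantified inside: one rate has to serve all truncations
  $\theta\ge\theta_1$, because the assertion on upper limits restarts the estimate at ever larger angles.
  The bounds $m$ on the curves and $M$ on the initial cross-section are arbitrary, not the suprema.
\<close>

definition decay_rate :: "real \<Rightarrow> bool" where
  "decay_rate \<nu> \<longleftrightarrow> (\<forall>u \<theta>1 m M \<theta> r. subsolution_class u \<longrightarrow> \<theta>0 \<le> \<theta>1 \<longrightarrow>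
     (\<forall>\<theta>\<ge>\<theta>1. u (polar (r1 \<theta>) \<theta>) \<le> m \<and> u (polar (r2 \<theta>) \<theta>) \<le> m) \<longrightarrow>
     (\<forall>r. r1 \<theta>1 \<le> r \<and> r \<le> r2 \<theta>1 \<longrightarrow> u (polar r \<theta>1) \<le> M) \<longrightarrow> m \<le> M \<longrightarrow>
     \<theta>1 \<le> \<theta> \<longrightarrow> r1 \<theta> \<le> r \<longrightarrow> r \<le> r2 \<theta> \<longrightarrow>
     u (polar r \<theta>) \<le> M \<and> u (polar r \<theta>) \<le> m + 2 * (M - m) * exp (- \<nu> * (\<theta> - \<theta>1)))"

lemma M1_nonneg: "M1 \<ge> 0"
proof -
  have "\<theta>0 < \<theta>0 + 1" by simp
  then obtain r where "r1 (\<theta>0 + 1) < r" "r < r2 (\<theta>0 + 1)" using nested[of "\<theta>0 + 1"] dense by auto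
  then have "polar r (\<theta>0 + 1) \<in> spiral_dom \<theta>0 r1 r2" by (intro polar_in_dom) auto
  from frame_coefficient_bounds(2,3)[OF this] show ?thesis by (metis order_trans)
qed

text \<open>
  The first bound is the comparison with $c=0$. For the second one, $c = (M-m)e^{\nu\theta_1}$ makes
  $m + c\,w_{-\nu}\ge M$ at the initial angle, by the lower bound on the barrier, and the upper bound on
  the barrier produces the factor $2$.
\<close>

lemma decay_rate_exists: "\<exists>\<nu>>0. decay_rate \<nu>"
proof -
  obtain R where R: "\<And>\<theta>. \<theta> \<ge> \<theta>0 \<Longrightarrow> r2 \<theta> \<le> R" using r2_upper by blast
  obtain k \<nu> where k: "0 < k" "0 < \<nu>" and op: "\<And>\<mu> r \<alpha> \<beta> \<delta> b1 b2. \<lbrakk>\<bar>\<mu>\<bar> \<le> \<nu>; rs \<le> r; r \<le> R; c0 \<le> \<alpha>; 0 \<le> \<delta>; \<delta> \<le> M1; \<bar>\<beta>\<bar> \<le> M1;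
       \<bar>b1\<bar> \<le> M2; \<bar>b2\<bar> \<le> M2\<rbrakk> \<Longrightarrow> 0 < barrier_op k R \<mu> r \<alpha> \<beta> \<delta> b1 b2"
    using barrier_constants[OF rs_pos c0_pos M1_nonneg M2_nonneg, of R] by metis
  have "decay_rate \<nu>"
    unfolding decay_rate_def
  proof (intro allI impI)
    fix u :: "real ^ 2 \<Rightarrow> real" and \<theta>1 m M \<theta> r
    assume "subsolution_class u" and \<theta>1: "\<theta>0 \<le> \<theta>1"
      and side: "\<forall>\<theta>\<ge>\<theta>1. u (polar (r1 \<theta>) \<theta>) \<le> m \<and> u (polar (r2 \<theta>) \<theta>) \<le> m"
      and base: "\<forall>r. r1 \<theta>1 \<le> r \<and> r \<le> r2 \<theta>1 \<longrightarrow> u (polar r \<theta>1) \<le> M" and mM: "m \<le> M"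
      and \<theta>: "\<theta>1 \<le> \<theta>" and r: "r1 \<theta> \<le> r" "r \<le> r2 \<theta>"
    then have u: "C2_on (spiral_dom \<theta>0 r1 r2) u" "continuous_on (spiral_ext \<theta>0 r1 r2) u"
      "below_exp_growth r1 r2 u" "\<And>x. x \<in> spiral_dom \<theta>0 r1 r2 \<Longrightarrow> ell_op A b u x \<le> 0"
      by (auto simp: subsolution_class_def)
    note comp = comparison[OF u less_imp_le[OF k(1)] k(2) R op \<theta>1 _ _ _ \<theta> r]
    have bar: "exp (- \<nu> * \<tau>) \<le> barrier k R (- \<nu>) s \<tau>" "barrier k R (- \<nu>) s \<tau> \<le> 2 * exp (- \<nu> * \<tau>)"
      if "\<theta>1 \<le> \<tau>" "r1 \<tau> \<le> s" "s \<le> r2 \<tau>" for s \<tau>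
      using barrier_bounds[of k s R "- \<nu>" \<tau>] that \<theta>1 R[of \<tau>] r1_lower[of \<tau>] rs_pos k by auto
    have "u (polar r \<theta>) \<le> M + 0 * barrier k R (- \<nu>) r \<theta>"
      by (rule comp) (use side base mM in \<open>auto intro: order_trans\<close>)
    then have 1: "u (polar r \<theta>) \<le> M" by simp
    define c where "c = (M - m) * exp (\<nu> * \<theta>1)"
    have c: "c \<ge> 0" using mM by (simp add: c_def)
    have "u (polar r \<theta>) \<le> m + c * barrier k R (- \<nu>) r \<theta>"
    proof (rule comp)
      fix \<tau> s assume \<tau>: "\<theta>1 \<le> \<tau>" "s = r1 \<tau> \<or> s = r2 \<tau>"
      then have "0 \<le> barrier k R (- \<nu>) s \<tau>"
        using bar(1)[of \<tau> s] nested[of \<tau>] \<theta>1 by (auto intro: order_trans[OF exp_ge_zero])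
      then have "0 \<le> c * barrier k R (- \<nu>) s \<tau>" using c by simp
      moreover have "u (polar s \<tau>) \<le> m" using side \<tau> by auto
      ultimately show "u (polar s \<tau>) \<le> m + c * barrier k R (- \<nu>) s \<tau>" by linarith
    next
      fix s assume s: "r1 \<theta>1 \<le> s" "s \<le> r2 \<theta>1"
      have "M = m + c * exp (- \<nu> * \<theta>1)" 
        using exp_minus_inverse[of "\<nu> * \<theta>1"] by (simp add: c_def mult.assoc)
      also have "\<dots> \<le> m + c * barrier k R (- \<nu>) s \<theta>1" using bar(1)[of \<theta>1 s] s c by (simp add: mult_left_mono)
      finally show "u (polar s \<theta>1) \<le> m + c * barrier k R (- \<nu>) s \<theta>1" using base s by fastforce
    qed (use c in auto)
    also have "\<dots> \<le> m + c * (2 * exp (- \<nu> * \<theta>))" using bar(2)[OF \<theta> r] c by (simp add: mult_left_mono)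
    also have "\<dots> = m + 2 * (M - m) * (exp (\<nu> * \<theta>1) * exp (- \<nu> * \<theta>))" by (simp add: c_def)
    also have "exp (\<nu> * \<theta>1) * exp (- \<nu> * \<theta>) = exp (- \<nu> * (\<theta> - \<theta>1))"
      by (simp add: exp_add[symmetric] algebra_simps)
    finally show "u (polar r \<theta>) \<le> M \<and> u (polar r \<theta>) \<le> m + 2 * (M - m) * exp (- \<nu> * (\<theta> - \<theta>1))"
      using 1 by simp
  qed
  with k show ?thesis by blast
qed

lemma cross_section_subset: "\<theta>0 \<le> \<theta> \<Longrightarrow> cross_section r1 r2 \<theta> \<subseteq> spiral_ext \<theta>0 r1 r2"
  by (auto simp: cross_section_def intro: polar_in_ext)

lemma section_nonempty: "\<theta>0 \<le> \<theta> \<Longrightarrow> cross_section r1 r2 \<theta> \<noteq> {}"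
  using nested[of \<theta>] by (intro cross_section_nonempty) auto

lemma section_bounded:
  assumes "continuous_on (spiral_ext \<theta>0 r1 r2) u" "\<theta>0 \<le> \<theta>"
  shows "bounded (u ` cross_section r1 r2 \<theta>)"
  using assms by (intro compact_imp_bounded compact_continuous_image compact_cross_section
      continuous_on_subset[OF assms(1)] cross_section_subset)

text \<open>
  The first claim follows by testing against every real upper bound $z$ of the right-hand side, with
  $m=M=z$, so that infinite values cause no case distinction. For the upper limits, pick $z$ just above the upper
  limit of the boundary values and an angle $\theta_1$ after which they stay below $z$. The estimate
  restarted at $\theta_1$ bounds $u$ by $z$ plus a term that tends to zero; the initial bound, taken on a
  compact cross-section, affects only the latter.
\<close>

lemma subsolution_estimates:
  assumes sub: "subsolution_class u" and bd: "bounded (u ` spiral_curves \<theta>0 r1 r2)"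
    and \<nu>: "decay_rate \<nu>" "\<nu> > 0"
  shows "(SUP x\<in>spiral_ext \<theta>0 r1 r2. ereal (u x))
      \<le> (SUP x\<in>cross_section r1 r2 \<theta>0 \<union> spiral_curves \<theta>0 r1 r2. ereal (u x))"
    and "\<And>\<theta>. \<theta> \<ge> \<theta>0 \<Longrightarrow> section_max r1 r2 u \<theta> \<le>
            (SUP x\<in>spiral_curves \<theta>0 r1 r2. u x) * (1 - 2 * exp (- \<nu> * (\<theta> - \<theta>0)))
            + 2 * (SUP x\<in>cross_section r1 r2 \<theta>0 \<union> spiral_curves \<theta>0 r1 r2. u x) * exp (- \<nu> * (\<theta> - \<theta>0))"
    and "Limsup at_top (\<lambda>\<theta>. ereal (section_max r1 r2 u \<theta>))
           \<le> Limsup at_top (\<lambda>\<theta>. ereal (curve_max r1 r2 u \<theta>))"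
proof -
  let ?\<gamma> = "spiral_curves \<theta>0 r1 r2" and ?S = "cross_section r1 r2 \<theta>0"
  have cont: "continuous_on (spiral_ext \<theta>0 r1 r2) u" using sub by (simp add: subsolution_class_def)
  have est: "u (polar r \<theta>) \<le> M" "u (polar r \<theta>) \<le> m + 2 * (M - m) * exp (- \<nu> * (\<theta> - \<theta>1))"
    if "\<theta>0 \<le> \<theta>1" "\<And>\<theta>. \<theta> \<ge> \<theta>1 \<Longrightarrow> u (polar (r1 \<theta>) \<theta>) \<le> m" "\<And>\<theta>. \<theta> \<ge> \<theta>1 \<Longrightarrow> u (polar (r2 \<theta>) \<theta>) \<le> m"
      "\<And>x. x \<in> cross_section r1 r2 \<theta>1 \<Longrightarrow> u x \<le> M" "m \<le> M" "\<theta>1 \<le> \<theta>" "r1 \<theta> \<le> r" "r \<le> r2 \<theta>"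
    for \<theta>1 m M \<theta> r
  proof -
    have "\<forall>r. r1 \<theta>1 \<le> r \<and> r \<le> r2 \<theta>1 \<longrightarrow> u (polar r \<theta>1) \<le> M"
      using that(4) by (auto simp: cross_section_def)
    then show "u (polar r \<theta>) \<le> M" "u (polar r \<theta>) \<le> m + 2 * (M - m) * exp (- \<nu> * (\<theta> - \<theta>1))"
      using \<nu>(1) sub that unfolding decay_rate_def by blast+
  qed
  have \<gamma>: "polar (r1 \<theta>) \<theta> \<in> ?\<gamma>" "polar (r2 \<theta>) \<theta> \<in> ?\<gamma>" if "\<theta>0 \<le> \<theta>" for \<theta>
    using that by (auto simp: spiral_curves_def)
  show "(SUP x\<in>spiral_ext \<theta>0 r1 r2. ereal (u x)) \<le> (SUP x\<in>?S \<union> ?\<gamma>. ereal (u x))"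
  proof (rule ereal_le_real)
    fix z assume "(SUP x\<in>?S \<union> ?\<gamma>. ereal (u x)) \<le> ereal z"
    then have z: "\<And>x. x \<in> ?S \<union> ?\<gamma> \<Longrightarrow> u x \<le> z" by (simp add: SUP_le_iff)
    show "(SUP x\<in>spiral_ext \<theta>0 r1 r2. ereal (u x)) \<le> ereal z"
    proof (rule SUP_least)
      fix x assume "x \<in> spiral_ext \<theta>0 r1 r2"
      then obtain r \<theta> where "x = polar r \<theta>" "\<theta>0 \<le> \<theta>" "r1 \<theta> \<le> r" "r \<le> r2 \<theta>"
        by (auto simp: spiral_ext_def)
      then show "ereal (u x) \<le> ereal z" using est(1)[of \<theta>0 z z \<theta> r] z \<gamma> by simp
    qed
  qed
  show "section_max r1 r2 u \<theta> \<le> (SUP x\<in>?\<gamma>. u x) * (1 - 2 * exp (- \<nu> * (\<theta> - \<theta>0)))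
      + 2 * (SUP x\<in>?S \<union> ?\<gamma>. u x) * exp (- \<nu> * (\<theta> - \<theta>0))" if \<theta>: "\<theta> \<ge> \<theta>0" for \<theta>
  proof -
    define m M where "m = (SUP x\<in>?\<gamma>. u x)" and "M = (SUP x\<in>?S \<union> ?\<gamma>. u x)"
    have b1: "bdd_above (u ` ?\<gamma>)" using bd by (rule bounded_imp_bdd_above)
    have b2: "bdd_above (u ` (?S \<union> ?\<gamma>))"
      unfolding image_Un using bd section_bounded[OF cont order_refl]
      by (simp add: bounded_imp_bdd_above)
    have m: "\<And>x. x \<in> ?\<gamma> \<Longrightarrow> u x \<le> m" unfolding m_def using b1 by (rule cSUP_upper2) auto
    have M: "\<And>x. x \<in> ?S \<union> ?\<gamma> \<Longrightarrow> u x \<le> M" unfolding M_def using b2 by (rule cSUP_upper2) auto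
    have "m \<le> M" unfolding m_def using \<gamma>(1)[of \<theta>0] M by (intro cSUP_least) auto
    have "section_max r1 r2 u \<theta> \<le> m + 2 * (M - m) * exp (- \<nu> * (\<theta> - \<theta>0))"
      unfolding section_max_def
    proof (rule cSUP_least[OF section_nonempty[OF \<theta>]])
      fix x assume "x \<in> cross_section r1 r2 \<theta>"
      then obtain r where "x = polar r \<theta>" "r1 \<theta> \<le> r" "r \<le> r2 \<theta>" by (auto simp: cross_section_def)
      then show "u x \<le> m + 2 * (M - m) * exp (- \<nu> * (\<theta> - \<theta>0))"
        using est(2)[of \<theta>0 m M \<theta> r] m M \<gamma> \<theta> \<open>m \<le> M\<close> by simp
    qed
    then show ?thesis unfolding m_def[symmetric] M_def[symmetric] by (simp add: algebra_simps)
  qed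
  show "Limsup at_top (\<lambda>\<theta>. ereal (section_max r1 r2 u \<theta>)) \<le> Limsup at_top (\<lambda>\<theta>. ereal (curve_max r1 r2 u \<theta>))"
    unfolding Limsup_le_iff
  proof (intro allI impI)
    fix y assume "Limsup at_top (\<lambda>\<theta>. ereal (curve_max r1 r2 u \<theta>)) < y"
    then obtain z where z: "Limsup at_top (\<lambda>\<theta>. ereal (curve_max r1 r2 u \<theta>)) < ereal z" "ereal z < y"
      using ereal_dense2 by blast
    \<comment> \<open>a second intermediate value leaves room for the exponential term to die out\<close>
    obtain w where w: "ereal z < ereal w" "ereal w < y" using ereal_dense2[OF z(2)] by blast
    have "\<forall>\<^sub>F \<theta> in at_top. \<theta>0 \<le> \<theta> \<and> ereal (curve_max r1 r2 u \<theta>) < ereal z"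
      by (rule eventually_conj[OF eventually_ge_at_top Limsup_lessD[OF z(1)]])
    then obtain \<theta>1 where t: "\<And>\<theta>. \<theta>1 \<le> \<theta> \<Longrightarrow> \<theta>0 \<le> \<theta> \<and> curve_max r1 r2 u \<theta> < z"
      unfolding eventually_at_top_linorder by auto
    have \<theta>1: "\<theta>0 \<le> \<theta>1" using t by blast
    obtain B where B: "\<And>x. x \<in> cross_section r1 r2 \<theta>1 \<Longrightarrow> u x \<le> B"
      using bounded_imp_bdd_above[OF section_bounded[OF cont \<theta>1]] unfolding bdd_above_def by auto
    define M where "M = max B z"
    have bound: "section_max r1 r2 u \<theta> \<le> z + 2 * (M - z) * exp (- \<nu> * (\<theta> - \<theta>1))" if \<theta>: "\<theta>1 \<le> \<theta>" for \<theta>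
      unfolding section_max_def
    proof (rule cSUP_least)
      show "cross_section r1 r2 \<theta> \<noteq> {}" using \<theta> \<theta>1 by (intro section_nonempty) simp
      fix x assume "x \<in> cross_section r1 r2 \<theta>"
      then obtain r where r: "x = polar r \<theta>" "r1 \<theta> \<le> r" "r \<le> r2 \<theta>" by (auto simp: cross_section_def)
      have "u (polar r \<theta>) \<le> z + 2 * (M - z) * exp (- \<nu> * (\<theta> - \<theta>1))"
        by (rule est(2)[OF \<theta>1 _ _ _ _ \<theta> r(2,3)])
          (use t B in \<open>fastforce simp: curve_max_def M_def le_max_iff_disj\<close>)+
      then show "u x \<le> z + 2 * (M - z) * exp (- \<nu> * (\<theta> - \<theta>1))" by (simp add: r)
    qed
    have "filterlim (\<lambda>\<theta>. - \<theta>1 + \<theta>) at_top at_top"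
      by (rule filterlim_tendsto_add_at_top[OF tendsto_const filterlim_ident])
    then have "filterlim (\<lambda>\<theta>. - \<nu> * (- \<theta>1 + \<theta>)) at_bot at_top"
      using \<nu>(2) by (intro filterlim_tendsto_neg_mult_at_bot[OF tendsto_const]) auto
    from filterlim_compose[OF exp_at_bot this]
    have "((\<lambda>\<theta>. exp (- \<nu> * (\<theta> - \<theta>1))) \<longlongrightarrow> 0) at_top" by simp
    then have "((\<lambda>\<theta>. z + 2 * (M - z) * exp (- \<nu> * (\<theta> - \<theta>1))) \<longlongrightarrow> z + 2 * (M - z) * 0) at_top"
      by (intro tendsto_intros)
    then have "\<forall>\<^sub>F \<theta> in at_top. z + 2 * (M - z) * exp (- \<nu> * (\<theta> - \<theta>1)) < w"
      using w(1) by (intro order_tendstoD(2)) auto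
    then show "\<forall>\<^sub>F \<theta> in at_top. ereal (section_max r1 r2 u \<theta>) < y"
      using eventually_ge_at_top[of \<theta>1]
    proof eventually_elim
      case (elim \<theta>)
      then have "ereal (section_max r1 r2 u \<theta>) < ereal w" using bound[of \<theta>] by simp
      then show ?case using w(2) by (rule less_trans)
    qed
  qed
qed

end

lemma section_max_uminus: "section_max r1 r2 (\<lambda>x. - u x) \<theta> = - section_min r1 r2 u \<theta>"
  by (simp add: section_max_def section_min_def Inf_real_def image_image)

lemma curve_max_uminus: "curve_max r1 r2 (\<lambda>x. - u x) \<theta> = - curve_min r1 r2 u \<theta>"
  by (simp add: curve_max_def curve_min_def max_def min_def)

lemma below_exp_growth_uminus: "below_exp_growth r1 r2 (\<lambda>x. - u x) = below_exp_growth r1 r2 u"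
  by (simp add: below_exp_growth_def)

lemma SUP_real_uminus: "(SUP x\<in>S. - f x) = - (INF x\<in>S. f x)" for f :: "'a \<Rightarrow> real"
  by (simp add: Inf_real_def image_image)

context spiral_operator
begin

lemma supersolution_estimates:
  assumes u: "C2_on (spiral_dom \<theta>0 r1 r2) u" "continuous_on (spiral_ext \<theta>0 r1 r2) u"
    "below_exp_growth r1 r2 u" "\<forall>x\<in>spiral_dom \<theta>0 r1 r2. ell_op A b u x \<ge> 0"
    and bd: "bounded (u ` spiral_curves \<theta>0 r1 r2)"
    and \<nu>: "decay_rate \<nu>" "\<nu> > 0"
  shows "(INF x\<in>spiral_ext \<theta>0 r1 r2. ereal (u x))
      \<ge> (INF x\<in>cross_section r1 r2 \<theta>0 \<union> spiral_curves \<theta>0 r1 r2. ereal (u x))"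
    and "\<And>\<theta>. \<theta> \<ge> \<theta>0 \<Longrightarrow> section_min r1 r2 u \<theta> \<ge>
            (INF x\<in>spiral_curves \<theta>0 r1 r2. u x) * (1 - 2 * exp (- \<nu> * (\<theta> - \<theta>0)))
            + 2 * (INF x\<in>cross_section r1 r2 \<theta>0 \<union> spiral_curves \<theta>0 r1 r2. u x) * exp (- \<nu> * (\<theta> - \<theta>0))"
    and "Liminf at_top (\<lambda>\<theta>. ereal (section_min r1 r2 u \<theta>))
           \<ge> Liminf at_top (\<lambda>\<theta>. ereal (curve_min r1 r2 u \<theta>))"
proof -
  have "subsolution_class (\<lambda>x. - u x)"
    using u by (simp add: subsolution_class_def C2_on_uminus open_spiral_dom below_exp_growth_uminus
        continuous_on_minus ell_op_uminus[OF open_spiral_dom])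
  moreover have "bounded ((\<lambda>x. - u x) ` spiral_curves \<theta>0 r1 r2)"
    using bd by (simp add: bounded_iff)
  ultimately have neg: "subsolution_class (\<lambda>x. - u x)" "bounded ((\<lambda>x. - u x) ` spiral_curves \<theta>0 r1 r2)" .
  note est = subsolution_estimates[OF neg \<nu>, unfolded section_max_uminus curve_max_uminus SUP_real_uminus,
      unfolded uminus_ereal.simps(1)[symmetric] ereal_SUP_uminus_eq ereal_Limsup_uminus ereal_minus_le_minus]
  show "(INF x\<in>spiral_ext \<theta>0 r1 r2. ereal (u x))
      \<ge> (INF x\<in>cross_section r1 r2 \<theta>0 \<union> spiral_curves \<theta>0 r1 r2. ereal (u x))"
    by (rule est(1))
  show "Liminf at_top (\<lambda>\<theta>. ereal (section_min r1 r2 u \<theta>)) \<ge> Liminf at_top (\<lambda>\<theta>. ereal (curve_min r1 r2 u \<theta>))"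
    by (rule est(3))
  show "section_min r1 r2 u \<theta> \<ge>
            (INF x\<in>spiral_curves \<theta>0 r1 r2. u x) * (1 - 2 * exp (- \<nu> * (\<theta> - \<theta>0)))
            + 2 * (INF x\<in>cross_section r1 r2 \<theta>0 \<union> spiral_curves \<theta>0 r1 r2. u x) * exp (- \<nu> * (\<theta> - \<theta>0))"
    if "\<theta> \<ge> \<theta>0" for \<theta>
    using est(2)[OF that] by (simp add: algebra_simps)
qed

end

theorem theorem5p1:
  fixes \<theta>0 rs c0 M1 M2 :: real
    and r1 r2 :: "real \<Rightarrow> real"
    and A :: "real ^ 2 \<Rightarrow> real ^ 2 ^ 2"
    and b :: "real ^ 2 \<Rightarrow> real ^ 2"
  defines "U \<equiv> spiral_dom \<theta>0 r1 r2"
    and "Ut \<equiv> spiral_ext \<theta>0 r1 r2"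
    and "\<gamma> \<equiv> spiral_curves \<theta>0 r1 r2"
    and "S \<equiv> cross_section r1 r2"
  assumes "continuous_on {\<theta>0..} r1" and "continuous_on {\<theta>0..} r2"
    and "\<And>\<theta>. \<theta> \<ge> \<theta>0 \<Longrightarrow> r1 \<theta> > 0" and "\<And>\<theta>. \<theta> \<ge> \<theta>0 \<Longrightarrow> r2 \<theta> > 0"
    and "\<And>\<theta>. \<theta> \<ge> \<theta>0 \<Longrightarrow> r2 (\<theta> + 2 * pi) < r1 \<theta> \<and> r1 \<theta> < r2 \<theta>"
    and "rs > 0" and "(r1 \<longlongrightarrow> rs) at_top" and "(r2 \<longlongrightarrow> rs) at_top"
    and "\<And>x. x \<in> U \<Longrightarrow> transpose (A x) = A x"
    and "c0 > 0" and "M1 > 0" and "M2 \<ge> 0"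
    and "\<And>x \<xi>. x \<in> U \<Longrightarrow> \<xi> \<bullet> (A x *v \<xi>) \<ge> c0 * (norm \<xi>)\<^sup>2"
    and "\<And>x. x \<in> U \<Longrightarrow> trace (A x) \<le> M1"
    and "\<And>x. x \<in> U \<Longrightarrow> norm (b x) \<le> M2"
  shows "\<exists>C>0. \<exists>\<nu>>0. \<forall>u :: real ^ 2 \<Rightarrow> real.
    C2_on U u \<and> continuous_on Ut u \<and> bounded (u ` \<gamma>) \<and> below_exp_growth r1 r2 u \<longrightarrow>
      ((\<forall>x\<in>U. ell_op A b u x \<le> 0) \<longrightarrow>
         (SUP x\<in>Ut. ereal (u x)) \<le> (SUP x\<in>S \<theta>0 \<union> \<gamma>. ereal (u x)) \<and>
         (\<forall>\<theta>\<ge>\<theta>0. section_max r1 r2 u \<theta> \<le>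
            (SUP x\<in>\<gamma>. u x) * (1 - C * exp (- \<nu> * (\<theta> - \<theta>0)))
            + C * (SUP x\<in>S \<theta>0 \<union> \<gamma>. u x) * exp (- \<nu> * (\<theta> - \<theta>0))) \<and>
         Limsup at_top (\<lambda>\<theta>. ereal (section_max r1 r2 u \<theta>))
           \<le> Limsup at_top (\<lambda>\<theta>. ereal (curve_max r1 r2 u \<theta>))) \<and>
      ((\<forall>x\<in>U. ell_op A b u x \<ge> 0) \<longrightarrow>
         (INF x\<in>Ut. ereal (u x)) \<ge> (INF x\<in>S \<theta>0 \<union> \<gamma>. ereal (u x)) \<and>
         (\<forall>\<theta>\<ge>\<theta>0. section_min r1 r2 u \<theta> \<ge>
            (INF x\<in>\<gamma>. u x) * (1 - C * exp (- \<nu> * (\<theta> - \<theta>0)))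
            + C * (INF x\<in>S \<theta>0 \<union> \<gamma>. u x) * exp (- \<nu> * (\<theta> - \<theta>0))) \<and>
         Liminf at_top (\<lambda>\<theta>. ereal (section_min r1 r2 u \<theta>))
           \<ge> Liminf at_top (\<lambda>\<theta>. ereal (curve_min r1 r2 u \<theta>)))"
proof -
  interpret spiral_operator \<theta>0 rs c0 M1 M2 r1 r2 A b
    using assms by unfold_locales (auto simp: U_def)
  obtain \<nu> where \<nu>: "\<nu> > 0" "decay_rate \<nu>" using decay_rate_exists by blast
  show ?thesis
    unfolding U_def Ut_def \<gamma>_def S_def
  proof (rule exI[of _ 2], intro conjI exI[of _ \<nu>] allI impI)
    show "(0 :: real) < 2" "0 < \<nu>" using \<nu> by simp_all
  next
    fix u :: "real ^ 2 \<Rightarrow> real"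
    assume u: "C2_on (spiral_dom \<theta>0 r1 r2) u \<and> continuous_on (spiral_ext \<theta>0 r1 r2) u \<and>
      bounded (u ` spiral_curves \<theta>0 r1 r2) \<and> below_exp_growth r1 r2 u"
    then have "subsolution_class u" if "\<forall>x\<in>spiral_dom \<theta>0 r1 r2. ell_op A b u x \<le> 0"
      using that by (simp add: subsolution_class_def)
    note sub = subsolution_estimates[OF this conjunct1[OF conjunct2[OF conjunct2[OF u]]] \<nu>(2,1)]
      and super = supersolution_estimates[OF conjunct1[OF u] conjunct1[OF conjunct2[OF u]]
          conjunct2[OF conjunct2[OF conjunct2[OF u]]] _ conjunct1[OF conjunct2[OF conjunct2[OF u]]] \<nu>(2,1)]
    show "(SUP x\<in>spiral_ext \<theta>0 r1 r2. ereal (u x)) \<le> (SUP x\<in>cross_section r1 r2 \<theta>0 \<union> spiral_curves \<theta>0 r1 r2. ereal (u x))"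
      if "\<forall>x\<in>spiral_dom \<theta>0 r1 r2. ell_op A b u x \<le> 0" by (rule sub(1)[OF that])
    show "section_max r1 r2 u \<theta> \<le> (SUP x\<in>spiral_curves \<theta>0 r1 r2. u x) * (1 - 2 * exp (- \<nu> * (\<theta> - \<theta>0)))
            + 2 * (SUP x\<in>cross_section r1 r2 \<theta>0 \<union> spiral_curves \<theta>0 r1 r2. u x) * exp (- \<nu> * (\<theta> - \<theta>0))"
      if "\<forall>x\<in>spiral_dom \<theta>0 r1 r2. ell_op A b u x \<le> 0" "\<theta>0 \<le> \<theta>" for \<theta> by (rule sub(2)[OF that])
    show "Limsup at_top (\<lambda>\<theta>. ereal (section_max r1 r2 u \<theta>)) \<le> Limsup at_top (\<lambda>\<theta>. ereal (curve_max r1 r2 u \<theta>))"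
      if "\<forall>x\<in>spiral_dom \<theta>0 r1 r2. ell_op A b u x \<le> 0" by (rule sub(3)[OF that])
    show "(INF x\<in>cross_section r1 r2 \<theta>0 \<union> spiral_curves \<theta>0 r1 r2. ereal (u x)) \<le> (INF x\<in>spiral_ext \<theta>0 r1 r2. ereal (u x))"
      if "\<forall>x\<in>spiral_dom \<theta>0 r1 r2. 0 \<le> ell_op A b u x" by (rule super(1)[OF that])
    show "(INF x\<in>spiral_curves \<theta>0 r1 r2. u x) * (1 - 2 * exp (- \<nu> * (\<theta> - \<theta>0)))
            + 2 * (INF x\<in>cross_section r1 r2 \<theta>0 \<union> spiral_curves \<theta>0 r1 r2. u x) * exp (- \<nu> * (\<theta> - \<theta>0))
            \<le> section_min r1 r2 u \<theta>"
      if "\<forall>x\<in>spiral_dom \<theta>0 r1 r2. 0 \<le> ell_op A b u x" "\<theta>0 \<le> \<theta>" for \<theta> by (rule super(2)[OF that])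
    show "Liminf at_top (\<lambda>\<theta>. ereal (curve_min r1 r2 u \<theta>)) \<le> Liminf at_top (\<lambda>\<theta>. ereal (section_min r1 r2 u \<theta>))"
      if "\<forall>x\<in>spiral_dom \<theta>0 r1 r2. 0 \<le> ell_op A b u x" by (rule super(3)[OF that])
  qed
qed

end
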